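(* $\dim_K \mathcal{E}_n(u)=n!\,B_n$, where $B_n$ is the Bell number, i.e. the number of set partitions of $\{1,\dots,n\}$. For example $\dim_K\mathcal{E}_2(u)=4$ and $\dim_K\mathcal{E}_3(u)=30$.
   Context: Let $u$ be an indeterminate, $\mathcal{A}=\mathbb{C}[u,u^{-1}]$ and $K=\mathbb{C}(u)$. $\mathcal{E}^{\mathcal{A}}_n(u)$ is the associative unital $\mathcal{A}$-algebra on generators $T_1,\dots,T_{n-1}$, $E_1,\dots,E_{n-1}$ with relations: (E1) $T_iT_j=T_jT_i$ if $|i-j|>1$; (E2) $E_iE_j=E_jE_i$ for all $i,j$; (E3) $E_iT_j=T_jE_i$ if $|i-j|>1$; (E4) $E_i^2=E_i$; (E5) $E_iT_i=T_iE_i$; (E6) $T_iT_jT_i=T_jT_iT_j$ if $|i-j|=1$; (E7) $E_jT_iT_j=T_iT_jE_i$ if $|i-j|=1$; (E8) $E_iE_jT_j=E_iT_jE_i=T_jE_iE_j$ if $|i-j|=1$; (E9) $T_i^2=1+(u-1)E_i(1+T_i)$. Put $\mathcal{E}_n(u)=\mathcal{E}^{\mathcal{A}}_n(u)\otimes_{\mathcal{A}}K$. *)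

theory Defs
  imports
    "HOL-Library.Poly_Mapping"
    "HOL-Library.Disjoint_Sets"
    "HOL-Computational_Algebra.Fraction_Field"
    "HOL-Computational_Algebra.Polynomial"
    "HOL-Algebra.QuotRing"
    "HOL-Algebra.Free_Abelian_Groups"
    "Jordan_Normal_Form.VS_Connect"
begin

subsection \<open>Coefficients\<close>

text \<open>
  The ring of Laurent polynomials \<open>\<complex>[u, u\<^sup>-\<^sup>1]\<close> is the group ring of the integers: the convolution
  ring of finitely supported functions \<open>int \<Rightarrow>\<^sub>0 complex\<close>, where \<open>k\<close> is the exponent of \<open>u\<close>.
\<close>

type_synonym laurent = "int \<Rightarrow>\<^sub>0 complex"

type_synonym ratfun = "complex poly fract"

definition laurent_u :: laurent where
  "laurent_u = Poly_Mapping.single 1 1"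

definition ratfun_u :: ratfun where
  "ratfun_u = Fract [:0, 1:] 1"

definition laurent_to_ratfun :: "laurent \<Rightarrow> ratfun" where
  "laurent_to_ratfun a =
     (\<Sum>k\<in>Poly_Mapping.keys a. Fract [:Poly_Mapping.lookup a k:] 1 * ratfun_u powi k)"

definition ratfun_module :: "(laurent, ratfun) module" where
  "ratfun_module =
     \<lparr>carrier = UNIV, monoid.mult = (*), monoid.one = 1, ring.zero = 0, ring.add = (+),
      smult = (\<lambda>a x. laurent_to_ratfun a * x)\<rparr>"

subsection \<open>Free associative algebras\<close>

text \<open>
  A copy of the type of lists, carrying the free monoid structure. The convolution product on
  \<open>'g word \<Rightarrow>\<^sub>0 'r\<close> then makes it the free associative unital \<open>'r\<close>-algebra on \<open>'g\<close>.
\<close>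

datatype 'g word = Word (letters: "'g list")

instantiation word :: (type) monoid_add
begin

definition zero_word :: "'a word" where
  "zero_word = Word []"

definition plus_word :: "'a word \<Rightarrow> 'a word \<Rightarrow> 'a word" where
  "plus_word v w = Word (letters v @ letters w)"

instance
  by standard (simp_all add: zero_word_def plus_word_def)

end

definition scale :: "'r::semiring_0 \<Rightarrow> ('g word \<Rightarrow>\<^sub>0 'r) \<Rightarrow> ('g word \<Rightarrow>\<^sub>0 'r)" where
  "scale a p = Poly_Mapping.map ((*) a) p"

definition free_algebra :: "'g set \<Rightarrow> ('r::ring_1, 'g word \<Rightarrow>\<^sub>0 'r) module" where
  "free_algebra X =
     \<lparr>carrier = {p. \<forall>w\<in>Poly_Mapping.keys p. set (letters w) \<subseteq> X},
      monoid.mult = (*), monoid.one = 1, ring.zero = 0, ring.add = (+), smult = scale\<rparr>"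

definition quotient_algebra ::
    "('r, 'a) module \<Rightarrow> 'a set \<Rightarrow> ('r, 'a set) module" where
  "quotient_algebra F I =
     \<lparr>carrier = carrier (F Quot I), monoid.mult = monoid.mult (F Quot I),
      monoid.one = monoid.one (F Quot I),
      ring.zero = ring.zero (F Quot I), ring.add = ring.add (F Quot I),
      smult = (\<lambda>a X. \<Union>p\<in>X. I +>\<^bsub>F\<^esub> (a \<odot>\<^bsub>F\<^esub> p))\<rparr>"

subsection \<open>Extension of scalars\<close>

definition tensor_relations ::
    "('r, 'm) module \<Rightarrow> ('r, 's) module \<Rightarrow> 'r set \<Rightarrow> ('m \<times> 's \<Rightarrow>\<^sub>0 int) set" where
  "tensor_relations M N R =
     {frag_of (m \<oplus>\<^bsub>M\<^esub> m', x) - frag_of (m, x) - frag_of (m', x) | m m' x.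
        m \<in> carrier M \<and> m' \<in> carrier M \<and> x \<in> carrier N} \<union>
     {frag_of (m, x \<oplus>\<^bsub>N\<^esub> x') - frag_of (m, x) - frag_of (m, x') | m x x'.
        m \<in> carrier M \<and> x \<in> carrier N \<and> x' \<in> carrier N} \<union>
     {frag_of (r \<odot>\<^bsub>M\<^esub> m, x) - frag_of (m, r \<odot>\<^bsub>N\<^esub> x) | r m x.
        r \<in> R \<and> m \<in> carrier M \<and> x \<in> carrier N}"

definition tensor_subgroup ::
    "('r, 'm) module \<Rightarrow> ('r, 's) module \<Rightarrow> 'r set \<Rightarrow> ('m \<times> 's \<Rightarrow>\<^sub>0 int) set" where
  "tensor_subgroup M N R =
     generate (free_Abelian_group (carrier M \<times> carrier N)) (tensor_relations M N R)"

text \<open>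
  For algebras \<open>M\<close> and \<open>S\<close> over a commutative ring with carrier \<open>R\<close>, where \<open>S\<close> is commutative, this
  is the \<open>S\<close>-algebra \<open>M \<otimes>\<^sub>R S\<close>. Its underlying group is the free abelian group on pairs modulo
  the bilinear balanced relations; the product and the action of \<open>S\<close> are induced by
  \<open>(m \<otimes> x)(m' \<otimes> x') = mm' \<otimes> xx'\<close> and \<open>y(m \<otimes> x) = m \<otimes> yx\<close>, extended additively to
  representatives.
\<close>

definition extend_scalars ::
    "('r, 'm) module \<Rightarrow> ('r, 's) module \<Rightarrow> 'r set \<Rightarrow> ('s, ('m \<times> 's \<Rightarrow>\<^sub>0 int) set) module" where
  "extend_scalars M S R =
     (let G = free_Abelian_group (carrier M \<times> carrier S); H = tensor_subgroup M S R in
      \<lparr>carrier = rcosets\<^bsub>G\<^esub> H,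
       monoid.mult = (\<lambda>X Y. \<Union>a\<in>X. \<Union>b\<in>Y. H #>\<^bsub>G\<^esub>
         frag_extend (\<lambda>(m, x).
           frag_extend (\<lambda>(m', x'). frag_of (m \<otimes>\<^bsub>M\<^esub> m', x \<otimes>\<^bsub>S\<^esub> x')) b) a),
       monoid.one = H #>\<^bsub>G\<^esub> frag_of (\<one>\<^bsub>M\<^esub>, \<one>\<^bsub>S\<^esub>),
       ring.zero = H,
       ring.add = (\<lambda>X Y. X <#>\<^bsub>G\<^esub> Y),
       smult = (\<lambda>y X. \<Union>a\<in>X. H #>\<^bsub>G\<^esub>
         frag_extend (\<lambda>(m, x). frag_of (m, y \<otimes>\<^bsub>S\<^esub> x)) a)\<rparr>)"

subsection \<open>The algebra of braids and ties\<close>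

datatype bt_gen = T_gen nat | E_gen nat

type_synonym bt_free = "bt_gen word \<Rightarrow>\<^sub>0 laurent"

definition bt_T :: "nat \<Rightarrow> bt_free" where
  "bt_T i = Poly_Mapping.single (Word [T_gen i]) 1"

definition bt_E :: "nat \<Rightarrow> bt_free" where
  "bt_E i = Poly_Mapping.single (Word [E_gen i]) 1"

definition bt_free_algebra :: "nat \<Rightarrow> (laurent, bt_free) module" where
  "bt_free_algebra n = free_algebra (T_gen ` {1..<n} \<union> E_gen ` {1..<n})"

definition far :: "nat \<Rightarrow> nat \<Rightarrow> bool" where
  "far i j \<longleftrightarrow> \<bar>int i - int j\<bar> > 1"

definition adjacent :: "nat \<Rightarrow> nat \<Rightarrow> bool" where
  "adjacent i j \<longleftrightarrow> \<bar>int i - int j\<bar> = 1"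

inductive bt_rel :: "nat \<Rightarrow> bt_free \<Rightarrow> bt_free \<Rightarrow> bool" for n :: nat where
  T_T_far: "\<lbrakk>i \<in> {1..<n}; j \<in> {1..<n}; far i j\<rbrakk> \<Longrightarrow>
    bt_rel n (bt_T i * bt_T j) (bt_T j * bt_T i)"
| E_E: "\<lbrakk>i \<in> {1..<n}; j \<in> {1..<n}\<rbrakk> \<Longrightarrow>
    bt_rel n (bt_E i * bt_E j) (bt_E j * bt_E i)"
| E_T_far: "\<lbrakk>i \<in> {1..<n}; j \<in> {1..<n}; far i j\<rbrakk> \<Longrightarrow>
    bt_rel n (bt_E i * bt_T j) (bt_T j * bt_E i)"
| E_idem: "i \<in> {1..<n} \<Longrightarrow>
    bt_rel n (bt_E i ^ 2) (bt_E i)"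
| E_T_same: "i \<in> {1..<n} \<Longrightarrow>
    bt_rel n (bt_E i * bt_T i) (bt_T i * bt_E i)"
| braid: "\<lbrakk>i \<in> {1..<n}; j \<in> {1..<n}; adjacent i j\<rbrakk> \<Longrightarrow>
    bt_rel n (bt_T i * bt_T j * bt_T i) (bt_T j * bt_T i * bt_T j)"
| E_T_T: "\<lbrakk>i \<in> {1..<n}; j \<in> {1..<n}; adjacent i j\<rbrakk> \<Longrightarrow>
    bt_rel n (bt_E j * bt_T i * bt_T j) (bt_T i * bt_T j * bt_E i)"
| E_E_T: "\<lbrakk>i \<in> {1..<n}; j \<in> {1..<n}; adjacent i j\<rbrakk> \<Longrightarrow>
    bt_rel n (bt_E i * bt_E j * bt_T j) (bt_E i * bt_T j * bt_E i)"
| E_T_E: "\<lbrakk>i \<in> {1..<n}; j \<in> {1..<n}; adjacent i j\<rbrakk> \<Longrightarrow>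
    bt_rel n (bt_E i * bt_T j * bt_E i) (bt_T j * bt_E i * bt_E j)"
| quadratic: "i \<in> {1..<n} \<Longrightarrow>
    bt_rel n (bt_T i ^ 2) (1 + scale (laurent_u - 1) (bt_E i * (1 + bt_T i)))"

definition bt_ideal :: "nat \<Rightarrow> bt_free set" where
  "bt_ideal n = Idl\<^bsub>bt_free_algebra n\<^esub> {x - y | x y. bt_rel n x y}"

definition bt_algebra_laurent :: "nat \<Rightarrow> (laurent, bt_free set) module" where
  "bt_algebra_laurent n = quotient_algebra (bt_free_algebra n) (bt_ideal n)"

definition bt_algebra :: "nat \<Rightarrow> (ratfun, (bt_free set \<times> ratfun \<Rightarrow>\<^sub>0 int) set) module" where
  "bt_algebra n = extend_scalars (bt_algebra_laurent n) ratfun_module UNIV"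

subsection \<open>Dimension and Bell numbers\<close>

text \<open>
  The library's \<^const>\<open>vectorspace.dim\<close> is a meaningful number only for vector spaces that have a
  finite spanning set, so both conditions are part of having dimension \<open>d\<close>.
\<close>

definition has_dim :: "'k ring \<Rightarrow> ('k, 'v) module \<Rightarrow> nat \<Rightarrow> bool" where
  "has_dim K V d \<longleftrightarrow>
     vectorspace K V \<and> vectorspace.fin_dim K V \<and> vectorspace.dim K V = d"

definition bell :: "nat \<Rightarrow> nat" where
  "bell n = card {P. partition_on {1..n} P}"

end

theory Submission
  imports Defs "HOL-Combinatorics.Permutations"
begin

text \<open>
  The upper bound comes from a spanning set: the algebra is spanned by products \<open>e\<^sub>P T\<^sub>w\<close>, where \<open>P\<close>
  is a set partition of \<open>{1..n}\<close> and \<open>w\<close> a permutation. The lower bound comes from a representation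
  in which equally many elements act as linearly independent operators.

  Spanning. The quadratic relation makes every \<open>T\<^sub>k\<close> invertible. Conjugating the \<open>E\<^sub>i\<close> by the \<open>T\<^sub>k\<close>
  gives one idempotent \<open>tie a b\<close> for every pair of points, and conjugation by \<open>T\<^sub>k\<close> then permutes
  these ties as the transposition of \<open>k\<close> and \<open>k + 1\<close> permutes the points (\<open>T_conj_tie\<close>). Ties commute,
  and \<open>tie a b * tie b c\<close> absorbs \<open>tie a c\<close> (\<open>tie_triangle\<close>); hence a product of ties depends only on
  the equivalence relation generated by its pairs (\<open>ties_eq\<close>), which leaves one idempotent for each set
  partition. For the \<open>T\<^sub>k\<close> one takes products of descending runs, one run
  \<open>T\<^sub>m T\<^sub>m\<^sub>-\<^sub>1 \<dots> T\<^sub>k\<close> for each \<open>m\<close>, of which there are \<open>n!\<close>. The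
  span of idempotents times such products contains \<open>1\<close> and is closed under right multiplication by
  the generators (\<open>normal_forms_mult_T\<close>), so it is everything (\<open>generated_spanned\<close>).

  This argument takes place in a ring, whereas the algebra is the quotient of a free algebra by an
  ideal that depends on \<open>n\<close>, and a type cannot depend on \<open>n\<close>. The product of the quotients over all
  \<open>n\<close> is a single type, and it is a ring; the argument is carried out there and read off in the
  component \<open>n\<close> (\<open>bt_spanning\<close>).

  Independence. On pairs \<open>(A, w)\<close> of an equivalence relation and a permutation, the expected rule
  for multiplying \<open>e\<^sub>A T\<^sub>w\<close> from the right by a generator defines operators on functions of
  \<open>(A, w)\<close>. They satisfy the defining relations (\<open>act_respects_relations\<close>), so the defining ideal
  acts as zero (\<open>act_ideal\<close>). Evaluating \<open>p f\<close> at the trivial relation and the identity turns every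
  element \<open>p\<close> into a functional, and for every \<open>(A, w)\<close> some \<open>p\<close> gives evaluation of \<open>f\<close> at \<open>(A, w)\<close>
  (\<open>reached_all\<close>). Evaluations at different points are linearly independent.

  The functionals extend to the tensor product with the field of rational functions, and the
  spanning set does too; comparing both sizes gives \<open>dimension_bt_algebra\<close>.
\<close>

section \<open>Adjacent transpositions\<close>

abbreviation adj :: "nat \<Rightarrow> nat \<Rightarrow> nat" where
  "adj k \<equiv> transpose k (Suc k)"

text \<open>
  The transposition of two points at distance \<open>d + 2\<close> is the conjugate of one at distance
  \<open>d + 1\<close> by an adjacent transposition.
\<close>

lemma transpose_by_adjacent:
  assumes step: "\<And>k p. \<lbrakk>1 \<le> k; k < n; P p\<rbrakk> \<Longrightarrow> P (p \<circ> adj k)"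
    and "1 \<le> a" "a + d < n" "P p"
  shows "P (p \<circ> transpose a (a + Suc d))"
  using assms(3,4)
proof (induction d arbitrary: p)
  case 0
  then show ?case using step[of a p] assms(2) by (simp del: comp_apply)
next
  case (Suc d)
  have k: "1 \<le> a + Suc d" "a + Suc d < n" using assms(2) Suc.prems by auto
  have 1: "P (p \<circ> adj (a + Suc d))" by (rule step[OF k Suc.prems(2)])
  have "P (p \<circ> adj (a + Suc d) \<circ> transpose a (a + Suc d))"
    by (rule Suc.IH[OF _ 1]) (use k in simp)
  hence "P (p \<circ> adj (a + Suc d) \<circ> transpose a (a + Suc d) \<circ> adj (a + Suc d))"
    by (rule step[OF k])
  moreover have "adj (a + Suc d) \<circ> transpose a (a + Suc d) \<circ> adj (a + Suc d)
      = transpose a (a + Suc (Suc d))"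
    by (auto simp: fun_eq_iff transpose_def)
  ultimately show ?case by (metis comp_assoc)
qed

text \<open>
  Adjacent transpositions generate the symmetric group. As an induction rule this serves twice: to
  extend conjugation from the \<open>T\<^sub>k\<close> to all permutations, and to reach every permutation in the
  representation.
\<close>

lemma permutes_adjacent_induct [consumes 1, case_names id adj]:
  assumes "p permutes {1..n}"
    and id: "P id"
    and step: "\<And>k p. \<lbrakk>1 \<le> k; k < n; P p\<rbrakk> \<Longrightarrow> P (p \<circ> adj k)"
  shows "P p"
proof -
  have tr: "P (p \<circ> transpose a b)" if "a \<in> {1..n}" "b \<in> {1..n}" "P p" for a b p
  proof -
    have *: "P (p \<circ> transpose a b)" if "a \<in> {1..n}" "b \<in> {1..n}" "P p" "a < b" for a b
    proof -
      obtain d where "b = a + Suc d" using \<open>a < b\<close> less_natE by auto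
      thus ?thesis using transpose_by_adjacent[where P=P and n=n and a=a and d=d, OF step] that by simp
    qed
    show ?thesis using that *[of a b] *[of b a]
      by (cases a b rule: linorder_cases) (auto simp: transpose_commute)
  qed
  show ?thesis
    using finite_atLeastAtMost assms(1)
    by (induction rule: permutes_rev_induct) (fact id, rule tr)
qed

text \<open>
  The symmetric group is transitive on tuples of distinct points, so that an identity between ties
  has to be checked for the points \<open>1, 2, 3, \<dots>\<close> only.
\<close>

lemma distinct_extends_to_permutation:
  assumes "distinct xs" "set xs \<subseteq> {1..n::nat}"
  shows "\<exists>p. p permutes {1..n} \<and> (\<forall>i<length xs. p (Suc i) = xs ! i)"
  using assms
proof (induction xs rule: rev_induct)
  case Nil
  show ?case by (auto intro: permutes_id)
next
  case (snoc x xs)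
  then obtain p where p: "p permutes {1..n}" "\<forall>i<length xs. p (Suc i) = xs ! i" by auto
  have "length xs < n"
    using snoc.prems distinct_card[of "xs @ [x]"] card_mono[of "{1..n}" "set (xs @ [x])"] by simp
  \<comment> \<open>Correcting the value at the next point leaves the earlier values alone, as they differ from
    both of the transposed points.\<close>
  let ?p = "transpose (p (Suc (length xs))) x \<circ> p"
  have "p (Suc (length xs)) \<in> {1..n}"
    using p(1) \<open>length xs < n\<close> by (simp add: permutes_in_image del: atLeastAtMost_iff) simp
  hence "?p permutes {1..n}"
    using snoc.prems p(1) by (intro permutes_compose permutes_swap_id) auto
  moreover have "?p (Suc i) = (xs @ [x]) ! i" if "i < length (xs @ [x])" for i
  proof (cases "i = length xs")
    case False
    hence i: "i < length xs" using that by simp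
    hence "p (Suc i) \<noteq> x" using p(2) snoc.prems nth_mem[OF i] by auto
    moreover have "p (Suc i) \<noteq> p (Suc (length xs))"
      using False permutes_inj[OF p(1)] by (auto dest: injD)
    ultimately show ?thesis using i p(2) by (simp add: nth_append)
  qed simp
  ultimately show ?case by blast
qed

section \<open>Equivalence relations generated by edges\<close>

text \<open>
  The equivalence relation on the whole type that is generated by a set of edges. Points that occur
  in no edge are classes of their own, which frees the definition from a carrier set.
\<close>

definition eqcl :: "('b \<times> 'b) set \<Rightarrow> ('b \<times> 'b) set" where
  "eqcl R = (R \<union> R\<inverse>)\<^sup>*"

lemma eqcl_equiv: "equiv UNIV (eqcl R)"
proof (rule equivI)
  show "refl (eqcl R)" by (auto simp: eqcl_def intro: refl_rtrancl)
  show "sym (eqcl R)" unfolding eqcl_def by (intro sym_rtrancl) (auto simp: sym_def)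
  show "trans (eqcl R)" unfolding eqcl_def by (rule trans_rtrancl)
qed simp

lemma eqcl_superset: "R \<subseteq> eqcl R"
  by (auto simp: eqcl_def)

lemma eqcl_least:
  assumes "equiv UNIV S" "R \<subseteq> S"
  shows "eqcl R \<subseteq> S"
proof clarify
  fix a b assume "(a, b) \<in> eqcl R"
  thus "(a, b) \<in> S" unfolding eqcl_def
  proof (induction rule: rtrancl_induct)
    case base
    show ?case using assms(1) by (auto elim!: equivE dest: refl_onD)
  next
    case (step b c)
    hence "(b, c) \<in> S" using assms by (meson Un_iff converseD equivE subsetD symD)
    thus ?case using step.IH assms(1) by (meson equivE transD)
  qed
qed

lemma eqcl_subset_iff: "eqcl R \<subseteq> eqcl S \<longleftrightarrow> R \<subseteq> eqcl S"
  using eqcl_superset eqcl_least[OF eqcl_equiv] by blast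

lemma eqcl_eqI: "R \<subseteq> eqcl S \<Longrightarrow> S \<subseteq> eqcl R \<Longrightarrow> eqcl R = eqcl S"
  by (simp add: eqcl_subset_iff set_eq_subset)

lemma eqcl_refl: "(a, a) \<in> eqcl R"
  by (simp add: eqcl_def)

lemma eqcl_sym: "(a, b) \<in> eqcl R \<Longrightarrow> (b, a) \<in> eqcl R"
  by (meson eqcl_equiv equivE symD)

lemma eqcl_trans: "(a, b) \<in> eqcl R \<Longrightarrow> (b, c) \<in> eqcl R \<Longrightarrow> (a, c) \<in> eqcl R"
  by (meson eqcl_equiv equivE transD)

definition block_pairs :: "'b set set \<Rightarrow> ('b \<times> 'b) set" where
  "block_pairs P = (\<Union>X\<in>P. X \<times> X)"

lemma block_pairs_quotient:
  assumes "equiv A r"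
  shows "block_pairs (A // r) = r"
proof
  have r: "refl_on A r" "sym r" "trans r" "r \<subseteq> A \<times> A" using assms by (auto elim: equivE)
  show "block_pairs (A // r) \<subseteq> r"
  proof clarify
    fix a b assume "(a, b) \<in> block_pairs (A // r)"
    then obtain x where "(x, a) \<in> r" "(x, b) \<in> r" by (auto simp: block_pairs_def quotient_def)
    thus "(a, b) \<in> r" using r by (meson symD transD)
  qed
  show "r \<subseteq> block_pairs (A // r)"
  proof clarify
    fix a b assume ab: "(a, b) \<in> r"
    hence a: "a \<in> A" using r by blast
    hence "r `` {a} \<in> A // r" "(a, a) \<in> r" using r by (auto intro: quotientI refl_onD)
    thus "(a, b) \<in> block_pairs (A // r)" using ab by (auto simp: block_pairs_def)
  qed
qed

text \<open>
  The blocks are the connected components of the graph with these edges.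
\<close>

lemma ex_partition_of_edges:
  assumes "R \<subseteq> A \<times> A"
  shows "\<exists>P. partition_on A P \<and> eqcl (block_pairs P) = eqcl R"
proof -
  let ?r = "eqcl R \<inter> A \<times> A"
  have e: "equiv A ?r"
    by (rule equivI) (auto simp: refl_on_def sym_def trans_def intro: eqcl_refl eqcl_sym eqcl_trans)
  have "eqcl ?r = eqcl R"
  proof (rule eqcl_eqI)
    show "R \<subseteq> eqcl ?r" using assms eqcl_superset[of R] eqcl_superset[of ?r] by blast
  qed simp
  thus ?thesis using partition_on_quotient[OF e] block_pairs_quotient[OF e]
    by (intro exI[of _ "A // ?r"]) simp
qed

section \<open>Conjugation by the braid generators\<close>

text \<open>
  The relations of the algebra of braids and ties, for elements of an arbitrary ring. The scalars
  come from a commutative ring through the central homomorphism \<open>\<iota>\<close>, and \<open>q\<close> with inverse \<open>q'\<close> takes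
  the place of \<open>u\<close>. The sort \<open>{ring, monoid_mult}\<close> is a ring with unit in which \<open>0 = 1\<close> is allowed:
  in a quotient, \<open>0 \<noteq> 1\<close> would be an additional claim.
\<close>

locale braids_and_ties =
  fixes n :: nat
    and T E :: "nat \<Rightarrow> 'a::{ring,monoid_mult}"
    and \<iota> :: "'k::comm_ring_1 \<Rightarrow> 'a" and q q' :: 'k
  assumes \<iota>_add: "\<iota> (a + b) = \<iota> a + \<iota> b"
    and \<iota>_mult: "\<iota> (a * b) = \<iota> a * \<iota> b"
    and \<iota>_one: "\<iota> 1 = 1"
    and \<iota>_central: "x * \<iota> a = \<iota> a * x"
    and q_inverse: "q * q' = 1"
    and TT_far: "\<lbrakk>i \<in> {1..<n}; j \<in> {1..<n}; far i j\<rbrakk> \<Longrightarrow> T i * T j = T j * T i"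
    and EE: "\<lbrakk>i \<in> {1..<n}; j \<in> {1..<n}\<rbrakk> \<Longrightarrow> E i * E j = E j * E i"
    and ET_far: "\<lbrakk>i \<in> {1..<n}; j \<in> {1..<n}; far i j\<rbrakk> \<Longrightarrow> E i * T j = T j * E i"
    and E_idem: "i \<in> {1..<n} \<Longrightarrow> E i * E i = E i"
    and ET_same: "i \<in> {1..<n} \<Longrightarrow> E i * T i = T i * E i"
    and braid: "\<lbrakk>i \<in> {1..<n}; j \<in> {1..<n}; adjacent i j\<rbrakk> \<Longrightarrow> T i * T j * T i = T j * T i * T j"
    and ETT: "\<lbrakk>i \<in> {1..<n}; j \<in> {1..<n}; adjacent i j\<rbrakk> \<Longrightarrow> E j * T i * T j = T i * T j * E i"
    and EET: "\<lbrakk>i \<in> {1..<n}; j \<in> {1..<n}; adjacent i j\<rbrakk> \<Longrightarrow> E i * E j * T j = E i * T j * E i"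
    and ETE: "\<lbrakk>i \<in> {1..<n}; j \<in> {1..<n}; adjacent i j\<rbrakk> \<Longrightarrow> E i * T j * E i = T j * E i * E j"
    and quad: "i \<in> {1..<n} \<Longrightarrow> T i * T i = 1 + \<iota> (q - 1) * (E i * (1 + T i))"
begin

text \<open>
  The inverse that the quadratic relation \<open>T\<^sub>i\<^sup>2 = 1 + (q - 1) E\<^sub>i (1 + T\<^sub>i)\<close> forces.
\<close>

definition T_inv :: "nat \<Rightarrow> 'a" where
  "T_inv i = T i + \<iota> (q' - 1) * E i + \<iota> (q' - 1) * (E i * T i)"

lemma \<iota>_0: "\<iota> 0 = 0"
  using \<iota>_add[of 0 0] by simp

lemma T_inverse: 
  assumes "i \<in> {1..<n}"
  shows "T i * T_inv i = 1" "T_inv i * T i = 1"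
proof -
  define x where "x = \<iota> (q - 1)"
  define y where "y = \<iota> (q' - 1)"
  \<comment> \<open>With \<open>x = q - 1\<close> and \<open>y = q' - 1\<close> this says \<open>(1 + x) (1 + y) = 1\<close>; the left-hand side is the
    coefficient of both \<open>E i\<close> and \<open>E i * T i\<close> in \<open>T_inv i * T i\<close>.\<close>
  have xy: "y * x + x + y = 0"
  proof -
    have "(q' - 1) * (q - 1) + (q - 1) + (q' - 1) = 0"
      using q_inverse by (simp add: algebra_simps)
    thus ?thesis unfolding x_def y_def by (metis \<iota>_0 \<iota>_add \<iota>_mult)
  qed
  have c: "T i * y = y * T i" "E i * y = y * E i" "T i * x = x * T i" "E i * x = x * E i" 
    unfolding x_def y_def by (simp_all add: \<iota>_central)
  have TT: "T i * T i = 1 + x * E i + x * (E i * T i)"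
    using quad[OF assms] by (simp add: x_def algebra_simps)
  have ETT: "E i * T i * T i = E i + x * E i + x * (E i * T i)"
  proof -
    have "E i * T i * T i = E i * (T i * T i)" by (simp add: mult.assoc)
    also have "\<dots> = E i + x * (E i * E i) + x * (E i * E i * T i)"
      unfolding TT by (simp add: distrib_left mult.assoc[symmetric] c)
    finally show ?thesis by (simp add: E_idem[OF assms])
  qed
  have "T_inv i * T i = T i * T i + y * (E i * T i) + y * (E i * T i * T i)"
    by (simp add: T_inv_def y_def distrib_right mult.assoc)
  also have "\<dots> = 1 + (y * x + x + y) * E i + (y * x + x + y) * (E i * T i)"
    unfolding TT ETT by (simp add: algebra_simps)
  finally show 1: "T_inv i * T i = 1" by (simp add: xy)
  have "T i * T_inv i = T_inv i * T i"
    using ET_same[OF assms] c(1) unfolding T_inv_def y_def[symmetric]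
    by (simp add: distrib_left distrib_right mult.assoc[symmetric]) (simp add: mult.assoc)
  thus "T i * T_inv i = 1" using 1 by simp
qed

definition T_conj :: "nat \<Rightarrow> 'a \<Rightarrow> 'a" where
  "T_conj k x = T k * x * T_inv k"

lemma T_mult_T_conj: "k \<in> {1..<n} \<Longrightarrow> T k * x = T_conj k x * T k"
  by (simp add: T_conj_def mult.assoc T_inverse)

lemma T_conj_eqI: "k \<in> {1..<n} \<Longrightarrow> T k * x = y * T k \<Longrightarrow> T_conj k x = y"
  by (simp add: T_conj_def mult.assoc T_inverse)

lemma T_conj_inj: "k \<in> {1..<n} \<Longrightarrow> T_conj k x = T_conj k y \<Longrightarrow> x = y"
  by (metis T_mult_T_conj T_inverse(2) mult.assoc mult_1)

lemma T_conj_far: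
  assumes "i \<in> {1..<n}" "j \<in> {1..<n}" "far i j"
  shows "T_conj i (T_conj j x) = T_conj j (T_conj i x)"
proof -
  have "T i * T_conj j x * T j = T i * T j * x" by (metis T_mult_T_conj assms(2) mult.assoc)
  also have "\<dots> = T j * T i * x" using TT_far[OF assms] by simp
  also have "\<dots> = T_conj j (T_conj i x) * T j * T i"
    using assms by (metis T_mult_T_conj mult.assoc)
  also have "\<dots> = T_conj j (T_conj i x) * T i * T j" using TT_far[OF assms] by (simp add: mult.assoc)
  finally have "T i * T_conj j x * T j * T_inv j = T_conj j (T_conj i x) * T i * T j * T_inv j" by simp
  hence "T i * T_conj j x = T_conj j (T_conj i x) * T i" using T_inverse[OF assms(2)] by (simp add: mult.assoc)
  thus ?thesis by (rule T_conj_eqI[OF assms(1)])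
qed

lemma cancel_T: "j \<in> {1..<n} \<Longrightarrow> x * T j = y * T j \<Longrightarrow> x = y"
  by (metis T_inverse(1) mult.assoc mult_1_right)

lemma T_conj_braid:
  assumes "i \<in> {1..<n}" "j \<in> {1..<n}" "adjacent i j"
  shows "T_conj i (T_conj j (T_conj i x)) = T_conj j (T_conj i (T_conj j x))"
proof -
  have 1: "T i * T j * T i * x = T_conj i (T_conj j (T_conj i x)) * (T i * T j * T i)"
    using assms(1,2) by (metis T_mult_T_conj mult.assoc)
  have 2: "T j * T i * T j * x = T_conj j (T_conj i (T_conj j x)) * (T j * T i * T j)"
    using assms(1,2) by (metis T_mult_T_conj mult.assoc)
  have "T_conj i (T_conj j (T_conj i x)) * T i * T j * T i = T_conj j (T_conj i (T_conj j x)) * T i * T j * T i"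
    using 1 2 braid[OF assms] by (metis mult.assoc)
  thus ?thesis using assms cancel_T by meson
qed

lemma T_conj_E_far: "\<lbrakk>i \<in> {1..<n}; j \<in> {1..<n}; far i j\<rbrakk> \<Longrightarrow> T_conj j (E i) = E i"
  by (rule T_conj_eqI) (simp_all add: ET_far)

lemma T_conj_E_same: "i \<in> {1..<n} \<Longrightarrow> T_conj i (E i) = E i"
  by (rule T_conj_eqI) (simp_all add: ET_same)

text \<open>
  This is the relation \<open>E\<^sub>j T\<^sub>i T\<^sub>j = T\<^sub>i T\<^sub>j E\<^sub>i\<close> in terms of conjugations.
\<close>

lemma T_conj_T_conj_E:
  assumes "i \<in> {1..<n}" "j \<in> {1..<n}" "adjacent i j"
  shows "T_conj i (T_conj j (E i)) = E j"
proof (rule T_conj_eqI[OF assms(1)], rule cancel_T[OF assms(2)])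
  have "T i * T_conj j (E i) * T j = T i * T j * E i"
    using T_mult_T_conj[OF assms(2)] by (simp add: mult.assoc)
  thus "T i * T_conj j (E i) * T j = E j * T i * T j" using ETT[OF assms] by simp
qed

text \<open>
  Conjugation by \<open>T\<^sub>j\<close> and by its inverse agree on \<open>E\<^sub>i\<close>, because \<open>T\<^sub>j\<^sup>2\<close> is a combination of \<open>1\<close>,
  \<open>E\<^sub>j\<close> and \<open>E\<^sub>j T\<^sub>j\<close>, and all of these commute with \<open>E\<^sub>i\<close>. This is what makes conjugation factor
  through the symmetric group on ties.
\<close>

lemma T_conj_square_E:
  assumes "i \<in> {1..<n}" "j \<in> {1..<n}" "adjacent i j"
  shows "T_conj j (T_conj j (E i)) = E i"
proof -
  have a: "adjacent j i" using assms(3) by (simp add: adjacent_def abs_minus_commute)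
  have 1: "E j * T j * E i = E i * (E j * T j)"
  proof -
    have "E j * T j * E i = T j * (E j * E i)"
      using ET_same assms by (simp add: mult.assoc)
    also have "\<dots> = T j * E i * E j" using EE assms by (simp add: mult.assoc)
    also have "\<dots> = E i * E j * T j" using EET ETE assms by simp
    finally show ?thesis by (simp add: mult.assoc)
  qed
  have "T j * T j * E i = E i * (T j * T j)"
    unfolding quad[OF assms(2)] using 1 EE[OF assms(1,2)]
    by (simp add: distrib_left distrib_right mult.assoc \<iota>_central)
       (metis \<iota>_central mult.assoc)
  hence "T_conj j (T_conj j (E i)) * T j * T j = E i * T j * T j"
    using assms(2) by (metis T_mult_T_conj mult.assoc)
  thus ?thesis using assms(2) cancel_T by blast
qed

section \<open>The ties of arbitrary pairs of points\<close>

text \<open>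
  The tie of \<open>i\<close> and \<open>i + d + 1\<close>, obtained from \<open>E\<^sub>i\<close> by moving the upper end one step at a time.
\<close>

fun tie_run :: "nat \<Rightarrow> nat \<Rightarrow> 'a" where
  "tie_run i 0 = E i"
| "tie_run i (Suc d) = T_conj (Suc (i + d)) (tie_run i d)"

lemma adjacentI: "adjacent i (Suc i)" "adjacent (Suc i) i"
  by (auto simp: adjacent_def)

lemma T_conj_tie_run_outside:
  assumes "1 \<le> i" "Suc (i + d) \<le> n" "k \<in> {1..<n}" "Suc k < i \<or> Suc (i + d) < k"
  shows "T_conj k (tie_run i d) = tie_run i d"
  using assms
proof (induction d)
  case 0
  then show ?case using T_conj_E_far[of i k] by (auto simp: far_def)
next
  case (Suc d)
  have "T_conj k (T_conj (Suc (i + d)) (tie_run i d)) = T_conj (Suc (i + d)) (T_conj k (tie_run i d))"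
    using Suc.prems by (intro T_conj_far) (auto simp: far_def)
  then show ?case using Suc by auto
qed

text \<open>
  Conjugation by \<open>T\<^sub>k\<close> can be moved inwards through far generators until the run contains
  \<open>T\<^sub>k T\<^sub>k\<^sub>+\<^sub>1 T\<^sub>k\<close>; after the braid relation the inner conjugation by \<open>T\<^sub>k\<^sub>+\<^sub>1\<close> no longer touches the
  shorter tie.
\<close>

lemma T_conj_tie_run_inside:
  assumes "1 \<le> i" "Suc (i + d) \<le> n" "i < k" "k < i + d"
  shows "T_conj k (tie_run i d) = tie_run i d"
  using assms
proof (induction d)
  case 0
  then show ?case by simp
next
  case (Suc d)
  show ?case
  proof (cases "k < i + d")
    case True
    have "T_conj k (T_conj (Suc (i + d)) (tie_run i d)) = T_conj (Suc (i + d)) (T_conj k (tie_run i d))"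
      using Suc.prems True by (intro T_conj_far) (auto simp: far_def)
    then show ?thesis using Suc True by auto
  next
    case False
    obtain e where "k = Suc (i + e)" using \<open>i < k\<close> less_natE by auto
    with False Suc.prems have d: "d = Suc e" "k = Suc (i + e)" by simp_all
    have "T_conj k (tie_run i (Suc d)) = T_conj k (T_conj (Suc k) (T_conj k (tie_run i e)))" using d by simp
    also have "\<dots> = T_conj (Suc k) (T_conj k (T_conj (Suc k) (tie_run i e)))"
      using Suc.prems d by (intro T_conj_braid) (auto intro: adjacentI)
    also have "T_conj (Suc k) (tie_run i e) = tie_run i e"
      using Suc.prems d by (intro T_conj_tie_run_outside) auto
    finally show ?thesis using d by simp
  qed
qed

lemma T_conj_tie_run_first:
  assumes "1 \<le> i" "Suc (i + Suc d) \<le> n"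
  shows "T_conj i (tie_run i (Suc d)) = tie_run (Suc i) d"
  using assms
proof (induction d)
  case 0
  then show ?case using T_conj_T_conj_E[of i "Suc i"] by (auto intro: adjacentI)
next
  case (Suc d)
  have "T_conj i (tie_run i (Suc (Suc d))) = T_conj (Suc (i + Suc d)) (T_conj i (tie_run i (Suc d)))"
    using Suc.prems T_conj_far[of i "Suc (i + Suc d)"] by (auto simp: far_def)
  then show ?case using Suc by simp
qed

text \<open>
  Moving the lower end commutes with conjugation at the upper end, which reduces the claim to
  neighbouring points.
\<close>

lemma T_conj_square_tie_run:
  assumes "1 \<le> i" "Suc (i + d) < n"
  shows "T_conj (Suc (i + d)) (T_conj (Suc (i + d)) (tie_run i d)) = tie_run i d"
  using assms
proof (induction d arbitrary: i)
  case 0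
  then show ?case using T_conj_square_E[of i "Suc i"] by (auto intro: adjacentI)
next
  case (Suc d)
  let ?k = "Suc (i + Suc d)"
  have i: "i \<in> {1..<n}" "?k \<in> {1..<n}" using Suc.prems by auto
  have *: "T_conj i (T_conj ?k x) = T_conj ?k (T_conj i x)" for x
    by (rule T_conj_far[OF i]) (auto simp: far_def)
  have "T_conj i (T_conj ?k (T_conj ?k (tie_run i (Suc d)))) = T_conj ?k (T_conj ?k (tie_run (Suc i) d))"
    unfolding * using T_conj_tie_run_first[of i d] Suc.prems by simp
  also have "\<dots> = tie_run (Suc i) d" using Suc.IH[of "Suc i"] Suc.prems by simp
  also have "\<dots> = T_conj i (tie_run i (Suc d))" using T_conj_tie_run_first[of i d] Suc.prems by simp
  finally show ?case by (rule T_conj_inj[OF i(1)])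
qed

lemma T_conj_tie_run_last:
  assumes "1 \<le> i" "Suc (i + Suc d) \<le> n"
  shows "T_conj (i + Suc d) (tie_run i (Suc d)) = tie_run i d"
  using T_conj_square_tie_run[of i d] assms by simp

text \<open>
  For neighbouring points both orders of conjugation by the generators \<open>i\<close> and \<open>i + 1\<close> have to give
  the same tie of \<open>i\<close> and \<open>i + 2\<close>, and this is where the squares of conjugations enter.
\<close>

lemma T_conj_tie_run_before:
  assumes "1 \<le> i" "Suc (Suc i + d) \<le> n"
  shows "T_conj i (tie_run (Suc i) d) = tie_run i (Suc d)"
  using assms
proof (induction d)
  case 0
  let ?j = "Suc i"
  have i: "i \<in> {1..<n}" "?j \<in> {1..<n}" using 0 by auto
  let ?Y = "T_conj i (E ?j)"
  have 1: "T_conj ?j ?Y = E i" using T_conj_T_conj_E[OF i(2,1)] by (simp add: adjacentI)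
  have "T_conj ?j (T_conj ?j (T_conj ?j ?Y)) = T_conj ?j ?Y"
    unfolding 1 by (rule T_conj_square_E[OF i]) (rule adjacentI)
  hence "T_conj ?j (T_conj ?j ?Y) = ?Y" by (rule T_conj_inj[OF i(2)])
  thus ?case using 1 by simp
next
  case (Suc d)
  have "T_conj i (tie_run (Suc i) (Suc d)) = T_conj (Suc (Suc i + d)) (T_conj i (tie_run (Suc i) d))"
    using Suc.prems T_conj_far[of i "Suc (Suc i + d)"] by (auto simp: far_def)
  then show ?case using Suc by simp
qed

definition tie :: "nat \<Rightarrow> nat \<Rightarrow> 'a" where
  "tie a b = (if a = b then 1 else tie_run (min a b) (max a b - Suc (min a b)))"

lemma tie_commute: "tie a b = tie b a"
  by (simp add: tie_def min.commute max.commute)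

lemma tie_same [simp]: "tie a a = 1"
  by (simp add: tie_def)

lemma tie_less: "tie i (Suc (i + d)) = tie_run i d"
  by (simp add: tie_def min_def max_def)

lemma tie_Suc: "tie i (Suc i) = E i"
  using tie_less[of i 0] by simp

lemma T_conj_one: "k \<in> {1..<n} \<Longrightarrow> T_conj k 1 = 1"
  by (simp add: T_conj_def T_inverse)

text \<open>
  The cases are the positions of \<open>k\<close> and \<open>k + 1\<close> relative to the two ends of the tie.
\<close>

lemma T_conj_tie_less:
  assumes "k \<in> {1..<n}" "1 \<le> i" "Suc (i + d) \<le> n"
  shows "T_conj k (tie_run i d) = tie (adj k i) (adj k (Suc (i + d)))"
proof -
  consider "Suc k < i" | "Suc (i + d) < k" | "i < k" "k < i + d" | "Suc k = i"
    | "k = i" "d = 0" | "k = i" "d > 0" | "k = i + d" "d > 0" | "k = Suc (i + d)"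
    by linarith
  thus ?thesis
  proof cases
    case 1
    thus ?thesis using T_conj_tie_run_outside[of i d k] assms by (simp add: tie_less[symmetric])
  next
    case 2
    thus ?thesis using T_conj_tie_run_outside[of i d k] assms by (simp add: tie_less[symmetric])
  next
    case 3
    thus ?thesis using T_conj_tie_run_inside[of i d k] assms by (simp add: tie_less[symmetric])
  next
    case 4
    thus ?thesis using T_conj_tie_run_before[of k d] assms tie_less[of k "Suc d"] by auto
  next
    case 5
    thus ?thesis using T_conj_E_same[of k] assms by (simp add: tie_commute[of "Suc i"] tie_Suc)
  next
    case 6
    then obtain e where "d = Suc e" using gr0_implies_Suc by auto
    thus ?thesis using 6 T_conj_tie_run_first[of i e] tie_less[of "Suc i" e] assms by simp
  next
    case 7
    then obtain e where "d = Suc e" using gr0_implies_Suc by auto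
    thus ?thesis using 7 T_conj_tie_run_last[of i e] tie_less[of i e] assms by simp
  next
    case 8
    thus ?thesis using tie_less[of i "Suc d"] by simp
  qed
qed

lemma T_conj_tie:
  assumes "k \<in> {1..<n}" "a \<in> {1..n}" "b \<in> {1..n}"
  shows "T_conj k (tie a b) = tie (adj k a) (adj k b)"
proof -
  have *: "T_conj k (tie a b) = tie (adj k a) (adj k b)" if "a < b" "a \<in> {1..n}" "b \<in> {1..n}" for a b
  proof -
    obtain d where "b = Suc (a + d)" using \<open>a < b\<close> less_natE by auto
    thus ?thesis using T_conj_tie_less[of k a d] assms(1) that by (simp add: tie_less)
  qed
  show ?thesis using *[of a b] *[of b a] assms
    by (cases a b rule: linorder_cases) (auto simp: T_conj_one tie_commute)
qed

lemma T_tie: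
  assumes "k \<in> {1..<n}" "a \<in> {1..n}" "b \<in> {1..n}"
  shows "T k * tie a b = tie (adj k a) (adj k b) * T k"
  using T_mult_T_conj[OF assms(1)] T_conj_tie[OF assms] by simp

text \<open>
  The element \<open>g\<close> is a product of generators \<open>T\<^sub>k\<close> along a factorisation of \<open>p\<close> into adjacent
  transpositions.
\<close>

lemma permutation_acts:
  assumes "p permutes {1..n}"
  shows "\<exists>g g'. g * g' = 1 \<and> g' * g = 1 \<and>
    (\<forall>a\<in>{1..n}. \<forall>b\<in>{1..n}. g * tie a b * g' = tie (p a) (p b))"
  using assms
proof (induction rule: permutes_adjacent_induct)
  case id
  show ?case by (intro exI[of _ 1]) auto
next
  case (adj k p)
  then obtain g g' where g: "g * g' = 1" "g' * g = 1"
    and E: "\<And>a b. a \<in> {1..n} \<Longrightarrow> b \<in> {1..n} \<Longrightarrow> g * tie a b * g' = tie (p a) (p b)" by blast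
  have k: "k \<in> {1..<n}" using adj by simp
  show ?case
  proof (intro exI conjI ballI)
    show "(g * T k) * (T_inv k * g') = 1" 
      using g T_inverse[OF k] by (metis mult.assoc mult_1_right)
    show "(T_inv k * g') * (g * T k) = 1"
      using g T_inverse[OF k] by (metis mult.assoc mult_1_left)
    fix a b assume ab: "a \<in> {1..n}" "b \<in> {1..n}"
    have "adj k a \<in> {1..n}" "adj k b \<in> {1..n}"
      using ab k by (auto simp: transpose_def)
    moreover have "g * T k * tie a b * (T_inv k * g') = g * T_conj k (tie a b) * g'"
      by (simp add: T_conj_def mult.assoc)
    ultimately show "g * T k * tie a b * (T_inv k * g') = tie ((p \<circ> adj k) a) ((p \<circ> adj k) b)"
      using T_conj_tie[OF k ab] E by simp
  qed
qed

text \<open>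
  One conjugation takes the ties of \<open>1, 2, 3, \<dots>\<close> simultaneously to the ties of given distinct
  points. Since conjugation is multiplicative, identities between ties are transported.
\<close>

lemma distinct_transport:
  assumes "distinct xs" "set xs \<subseteq> {1..n}"
  shows "length xs \<le> n"
    and "\<exists>g g'. g' * g = 1 \<and> (\<forall>i<length xs. \<forall>j<length xs.
            tie (xs ! i) (xs ! j) = g * tie (Suc i) (Suc j) * g')"
proof -
  obtain p where p: "p permutes {1..n}" "\<forall>i<length xs. p (Suc i) = xs ! i"
    using distinct_extends_to_permutation[OF assms] by blast
  show l: "length xs \<le> n"
    using assms distinct_card[of xs] card_mono[of "{1..n}" "set xs"] by simp
  obtain g g' where g: "g' * g = 1"
    "\<forall>a\<in>{1..n}. \<forall>b\<in>{1..n}. g * tie a b * g' = tie (p a) (p b)"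
    using permutation_acts[OF p(1)] by blast
  show "\<exists>g g'. g' * g = 1 \<and> (\<forall>i<length xs. \<forall>j<length xs.
            tie (xs ! i) (xs ! j) = g * tie (Suc i) (Suc j) * g')"
    using g p(2) l by (intro exI[of _ g] exI[of _ g']) auto
qed

lemma conj_mult: "(g' :: 'a) * g = 1 \<Longrightarrow> (g * x * g') * (g * y * g') = g * (x * y) * g'"
  by (metis mult.assoc mult_1_left)

lemma tie_run_idem: "1 \<le> i \<Longrightarrow> Suc (i + d) \<le> n \<Longrightarrow> tie_run i d * tie_run i d = tie_run i d"
proof (induction d)
  case 0
  then show ?case using E_idem by simp
next
  case (Suc d)
  have "T_conj k x * T_conj k x = T_conj k (x * x)" if "k \<in> {1..<n}" for k x
    unfolding T_conj_def using T_inverse[OF that] by (intro conj_mult)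
  then show ?case using Suc by simp
qed

lemma tie_idem:
  assumes "a \<in> {1..n}" "b \<in> {1..n}"
  shows "tie a b * tie a b = tie a b"
  using assms by (auto simp: tie_def min_def max_def intro!: tie_run_idem)

lemma tie_mult_share:
  assumes "a \<in> {1..n}" "b \<in> {1..n}" "c \<in> {1..n}"
  shows "tie a b * tie b c = tie b c * tie a b"
proof (cases "distinct [a, b, c]")
  case True
  have "set [a, b, c] \<subseteq> {1..n}" using assms by simp
  note tr = distinct_transport[OF True this]
  note l = tr(1)
  obtain g g' where g: "g' * g = 1" and *: "\<forall>i<length [a, b, c]. \<forall>j<length [a, b, c].
      tie ([a, b, c] ! i) ([a, b, c] ! j) = g * tie (Suc i) (Suc j) * g'"
    using tr(2) by blast
  have "tie a b = g * E 1 * g'" "tie b c = g * E 2 * g'"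
    using *[rule_format, of 0 1] *[rule_format, of 1 2] tie_Suc[of 1] tie_Suc[of 2] by (simp_all add: numeral_2_eq_2 numeral_3_eq_3)
  thus ?thesis using EE[of 1 2] g l by (simp add: conj_mult)
qed (auto simp: tie_commute)

lemma tie_mult_commute:
  assumes "a \<in> {1..n}" "b \<in> {1..n}" "c \<in> {1..n}" "d \<in> {1..n}"
  shows "tie a b * tie c d = tie c d * tie a b"
proof (cases "distinct [a, b, c, d]")
  case True
  have "set [a, b, c, d] \<subseteq> {1..n}" using assms by simp
  note tr = distinct_transport[OF True this]
  note l = tr(1)
  obtain g g' where g: "g' * g = 1" and *: "\<forall>i<length [a, b, c, d]. \<forall>j<length [a, b, c, d].
      tie ([a, b, c, d] ! i) ([a, b, c, d] ! j) = g * tie (Suc i) (Suc j) * g'"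
    using tr(2) by blast
  have "tie a b = g * E 1 * g'" "tie c d = g * E 3 * g'"
    using *[rule_format, of 0 1] *[rule_format, of 2 3] tie_Suc[of 1] tie_Suc[of 3] by (simp_all add: numeral_2_eq_2 numeral_3_eq_3)
  thus ?thesis using EE[of 1 3] g l by (simp add: conj_mult)
next
  case False
  then consider "a = b \<or> c = d" | "a = c" | "a = d" | "b = c" | "b = d" by auto
  thus ?thesis by cases (auto, (metis tie_commute tie_mult_share assms)+)
qed

text \<open>
  For the points \<open>1, 2, 3\<close> the claim is \<open>E\<^sub>1 E\<^sub>2 (T\<^sub>2 E\<^sub>1 T\<^sub>2\<^sup>-\<^sup>1) = E\<^sub>1 E\<^sub>2\<close>. It holds because
  \<open>E\<^sub>1 E\<^sub>2 T\<^sub>2\<close> equals \<open>T\<^sub>2 E\<^sub>1 E\<^sub>2\<close>, and the latter absorbs \<open>E\<^sub>1\<close> from the right.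
\<close>

lemma tie_triangle:
  assumes "a \<in> {1..n}" "b \<in> {1..n}" "c \<in> {1..n}"
  shows "tie a b * tie b c * tie a c = tie a b * tie b c"
proof (cases "distinct [a, b, c]")
  case True
  have "set [a, b, c] \<subseteq> {1..n}" using assms by simp
  note tr = distinct_transport[OF True this]
  note l = tr(1)
  obtain g g' where g: "g' * g = 1" and *: "\<forall>i<length [a, b, c]. \<forall>j<length [a, b, c].
      tie ([a, b, c] ! i) ([a, b, c] ! j) = g * tie (Suc i) (Suc j) * g'"
    using tr(2) by blast
  have r: "1 \<in> {1..<n}" "2 \<in> {1..<n}" "adjacent 1 2" using l by (auto simp: adjacent_def)
  have "E 1 * E 2 * T 2 * E 1 = E 1 * E 2 * T 2"
  proof -
    have "E 1 * E 2 * T 2 * E 1 = T 2 * E 1 * E 2 * E 1"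
      using EET[OF r] ETE[OF r] by simp
    also have "\<dots> = T 2 * E 1 * E 2"
      using EE[OF r(1,2)] E_idem[OF r(1)] by (metis mult.assoc)
    finally show ?thesis using EET[OF r] ETE[OF r] by simp
  qed
  hence "E 1 * E 2 * T 2 * E 1 * T_inv 2 = E 1 * E 2 * T 2 * T_inv 2" by simp
  hence "E 1 * E 2 * T_conj 2 (E 1) = E 1 * E 2"
    using T_inverse[OF r(2)] by (simp add: T_conj_def mult.assoc)
  moreover have "tie 1 3 = T_conj 2 (E 1)" using tie_less[of 1 1] by (simp add: numeral_2_eq_2 numeral_3_eq_3)
  moreover have "tie a b = g * E 1 * g'" "tie b c = g * E 2 * g'" "tie a c = g * tie 1 3 * g'"
    using *[rule_format, of 0 1] *[rule_format, of 1 2] *[rule_format, of 0 2] tie_Suc[of 1] tie_Suc[of 2] by (simp_all add: numeral_2_eq_2 numeral_3_eq_3)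
  ultimately show ?thesis using g by (simp add: conj_mult)
next
  case False
  then consider "a = b" | "b = c" | "a = c" by auto
  thus ?thesis using tie_idem assms by cases (auto simp: tie_commute[of c b] mult.assoc)
qed

definition ties :: "(nat \<times> nat) list \<Rightarrow> 'a" where
  "ties xs = prod_list (map (\<lambda>(a, b). tie a b) xs)"

abbreviation edge_list :: "(nat \<times> nat) list \<Rightarrow> bool" where
  "edge_list xs \<equiv> set xs \<subseteq> {1..n} \<times> {1..n}"

lemma ties_simps [simp]: "ties [] = 1" "ties ((a, b) # xs) = tie a b * ties xs" "ties (xs @ ys) = ties xs * ties ys"
  by (simp_all add: ties_def)

lemma ties_mult_tie:
  assumes "edge_list xs" "a \<in> {1..n}" "b \<in> {1..n}"
  shows "ties xs * tie a b = tie a b * ties xs"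
  using assms(1)
proof (induction xs)
  case (Cons x xs)
  obtain c d where x: "x = (c, d)" by (cases x)
  have "tie c d * ties xs * tie a b = tie c d * tie a b * ties xs"
    using Cons by (simp add: mult.assoc)
  also have "tie c d * tie a b = tie a b * tie c d"
    using Cons.prems assms x by (intro tie_mult_commute) auto
  finally show ?case by (simp add: x mult.assoc)
qed simp

lemma ties_mult_ties: "edge_list xs \<Longrightarrow> edge_list ys \<Longrightarrow> ties xs * ties ys = ties ys * ties xs"
proof (induction ys)
  case (Cons y ys)
  obtain c d where y: "y = (c, d)" by (cases y)
  have "ties xs * tie c d * ties ys = tie c d * (ties xs * ties ys)"
    using Cons.prems y by (subst ties_mult_tie) (auto simp: mult.assoc)
  then show ?case using Cons y by (simp add: mult.assoc)
qed simp

lemma ties_absorb_member: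
  assumes "edge_list xs" "(a, b) \<in> set xs"
  shows "ties xs * tie a b = ties xs"
  using assms
proof (induction xs)
  case (Cons x xs)
  obtain c d where x: "x = (c, d)" by (cases x)
  show ?case
  proof (cases "(a, b) \<in> set xs")
    case True
    then show ?thesis using Cons x by (simp add: mult.assoc)
  next
    case False
    hence "x = (a, b)" using Cons.prems by auto
    moreover have "tie a b * ties xs * tie a b = tie a b * tie a b * ties xs"
      using Cons.prems by (subst mult.assoc, subst ties_mult_tie) (auto simp: mult.assoc)
    ultimately show ?thesis using Cons.prems tie_idem[of a b] by auto
  qed
qed simp

text \<open>
  The pairs whose tie is absorbed by a product of ties form an equivalence relation; transitivity is
  \<open>tie_triangle\<close>. Hence the product absorbs every tie of the relation generated by its pairs.
\<close>

lemma ties_absorb: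
  assumes "edge_list xs" "a \<in> {1..n}" "(a, b) \<in> eqcl (set xs)"
  shows "b \<in> {1..n} \<and> ties xs * tie a b = ties xs"
  using assms(3) unfolding eqcl_def
proof (induction rule: rtrancl_induct)
  case base
  then show ?case using assms by simp
next
  case (step b c)
  have c: "c \<in> {1..n}" and 1: "ties xs * tie b c = ties xs"
    using step.hyps(2) assms(1) ties_absorb_member[of xs b c] ties_absorb_member[of xs c b]
    by (auto simp: tie_commute[of b c])
  have "ties xs * tie a c = ties xs * (tie a b * tie b c * tie a c)"
    using step.IH 1 by (metis mult.assoc)
  also have "\<dots> = ties xs * (tie a b * tie b c)"
    using tie_triangle step.IH assms(2) c by simp
  also have "\<dots> = ties xs" using step.IH 1 by (metis mult.assoc)
  finally show ?case using c by simp
qed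

text \<open>
  Each of the two products absorbs all factors of the other, and they commute, so both are equal to
  their product.
\<close>

lemma ties_eq:
  assumes "edge_list xs" "edge_list ys" "eqcl (set xs) = eqcl (set ys)"
  shows "ties xs = ties ys"
proof -
  have *: "ties xs * ties zs = ties xs" if "edge_list xs" "edge_list zs" "set zs \<subseteq> eqcl (set xs)" for xs zs
    using that(2,3)
  proof (induction zs)
    case (Cons z zs)
    obtain c d where z: "z = (c, d)" by (cases z)
    have "ties xs * ties (z # zs) = ties xs * tie c d * ties zs" using z by (simp add: mult.assoc)
    also have "\<dots> = ties xs" using ties_absorb[OF that(1), of c d] Cons z by simp
    finally show ?case .
  qed simp
  have "ties xs = ties xs * ties ys"
    using *[of xs ys] assms eqcl_superset[of "set ys"] by simp
  also have "\<dots> = ties ys * ties xs" by (rule ties_mult_ties[OF assms(1,2)])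
  also have "\<dots> = ties ys"
    using *[of ys xs] assms eqcl_superset[of "set xs"] by simp
  finally show ?thesis .
qed

text \<open>
  The product of all ties inside the blocks of a partition. A list is chosen because the ring is not
  commutative; by \<open>ties_eq\<close> the choice has no influence.
\<close>

definition partition_idem :: "nat set set \<Rightarrow> 'a" where
  "partition_idem P = ties (SOME xs. set xs = block_pairs P)"

lemma ties_eq_partition_idem:
  assumes "edge_list xs"
  shows "\<exists>P. partition_on {1..n} P \<and> ties xs = partition_idem P"
proof -
  obtain P where P: "partition_on {1..n} P" "eqcl (block_pairs P) = eqcl (set xs)"
    using ex_partition_of_edges[OF assms] by blast
  have sub: "block_pairs P \<subseteq> {1..n} \<times> {1..n}"
    using partition_onD1[OF P(1)] by (auto simp: block_pairs_def)
  hence "finite (block_pairs P)" by (rule finite_subset) simp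
  hence "set (SOME xs. set xs = block_pairs P) = block_pairs P"
    using finite_list[of "block_pairs P"] by (rule_tac someI_ex) auto
  hence "ties xs = partition_idem P"
    unfolding partition_idem_def using assms P(2) sub by (intro ties_eq) auto
  thus ?thesis using P(1) by blast
qed

section \<open>Normal forms\<close>

inductive_set lspan :: "'a set \<Rightarrow> 'a set" for B :: "'a set" where
  zero: "0 \<in> lspan B"
| step: "b \<in> B \<Longrightarrow> x \<in> lspan B \<Longrightarrow> \<iota> c * b + x \<in> lspan B"

lemma lspan_add: "x \<in> lspan B \<Longrightarrow> y \<in> lspan B \<Longrightarrow> x + y \<in> lspan B"
  by (induction rule: lspan.induct) (auto simp: add.assoc intro: lspan.step)

lemma lspan_base: "b \<in> B \<Longrightarrow> b \<in> lspan B"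
  using lspan.step[of b B 0 1] lspan.zero by (simp add: \<iota>_one)

lemma lspan_scale: "x \<in> lspan B \<Longrightarrow> \<iota> c * x \<in> lspan B"
proof (induction rule: lspan.induct)
  case (step b x d)
  have "\<iota> c * (\<iota> d * b + x) = \<iota> (c * d) * b + \<iota> c * x"
    by (simp add: distrib_left \<iota>_mult mult.assoc)
  then show ?case using step lspan.step by metis
qed (simp add: lspan.zero)

lemma lspan_mult:
  assumes "x \<in> lspan B" "\<And>b. b \<in> B \<Longrightarrow> b * y \<in> lspan C"
  shows "x * y \<in> lspan C"
  using assms(1)
  by (induction rule: lspan.induct)
     (auto simp: lspan.zero distrib_right mult.assoc intro: lspan_add lspan_scale assms(2))

lemma lspan_finite:
  assumes "finite B" "x \<in> lspan B"
  shows "\<exists>c. x = (\<Sum>b\<in>B. \<iota> (c b) * b)"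
  using assms(2)
proof (induction rule: lspan.induct)
  case zero
  show ?case by (rule exI[of _ "\<lambda>_. 0"]) (simp add: \<iota>_0)
next
  case (step b x c)
  then obtain d where d: "x = (\<Sum>b\<in>B. \<iota> (d b) * b)" by blast
  have "(\<Sum>y\<in>B. \<iota> (if y = b then c + d y else d y) * y)
      = (\<Sum>y\<in>B. (if y = b then \<iota> c * b else 0) + \<iota> (d y) * y)"
    by (intro sum.cong) (auto simp: \<iota>_add distrib_right)
  also have "\<dots> = \<iota> c * b + x"
    using step.hyps(1) assms(1) by (simp add: sum.distrib d)
  finally show ?case by metis
qed

text \<open>
  The descending product \<open>T\<^sub>m T\<^sub>m\<^sub>-\<^sub>1 \<dots> T\<^sub>k\<close>, which is \<open>1\<close> for \<open>k = m + 1\<close>.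
\<close>

fun T_run :: "nat \<Rightarrow> nat \<Rightarrow> 'a" where
  "T_run 0 k = 1"
| "T_run (Suc m) k = (if k \<le> Suc m then T (Suc m) * T_run m k else 1)"

text \<open>
  Every permutation of \<open>m + 2\<close> points is a permutation of the first \<open>m + 1\<close> points times one of the
  \<open>m + 2\<close> runs \<open>T\<^sub>m\<^sub>+\<^sub>1 \<dots> T\<^sub>k\<close>; iterating this, \<open>T_forms m\<close> has one product of runs for each
  permutation of \<open>m + 1\<close> points.
\<close>

fun T_forms :: "nat \<Rightarrow> 'a set" where
  "T_forms 0 = {1}"
| "T_forms (Suc m) = (\<lambda>(C, k). C * T_run (Suc m) k) ` (T_forms m \<times> {1..m + 2})"

lemma card_T_forms: "finite (T_forms m)" "card (T_forms m) \<le> fact (Suc m)"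
proof (induction m)
  case (Suc m)
  show "finite (T_forms (Suc m))" using Suc by simp
  have "card (T_forms (Suc m)) \<le> card (T_forms m \<times> {1..m + 2})"
    unfolding T_forms.simps using Suc by (intro card_image_le) auto
  also have "\<dots> = card (T_forms m) * (m + 2)" by (simp add: card_cartesian_product)
  also have "\<dots> \<le> fact (Suc m) * (m + 2)" by (rule mult_le_mono1[OF Suc(2)])
  finally show "card (T_forms (Suc m)) \<le> fact (Suc (Suc m))" by (simp add: mult.commute)
qed simp_all

lemma T_run_empty: "T_run m (Suc m) = 1"
  by (cases m) auto

lemma T_run_unfold_right: "1 \<le> k \<Longrightarrow> k \<le> m \<Longrightarrow> T_run m k = T_run m (Suc k) * T k"
proof (induction m)
  case (Suc m)
  then show ?case by (cases "k \<le> m") (auto simp: mult.assoc T_run_empty le_Suc_eq)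
qed simp

lemma T_run_mult_T_low:
  assumes "1 \<le> i" "Suc i < k" "m < n"
  shows "T_run m k * T i = T i * T_run m k"
  using assms(3)
proof (induction m)
  case (Suc m)
  show ?case
  proof (cases "k \<le> Suc m")
    case True
    have "T (Suc m) * T i = T i * T (Suc m)"
      using True assms Suc.prems by (intro TT_far) (auto simp: far_def)
    thus ?thesis using Suc by (simp add: mult.assoc) (simp add: mult.assoc[symmetric])
  qed simp
qed simp

text \<open>
  A generator inside the range of a run passes through it and loses one in its index: where it meets
  its two neighbours, the braid relation turns \<open>T\<^sub>i T\<^sub>i\<^sub>-\<^sub>1 T\<^sub>i\<close> into \<open>T\<^sub>i\<^sub>-\<^sub>1 T\<^sub>i T\<^sub>i\<^sub>-\<^sub>1\<close>.
\<close>

lemma T_run_mult_T_high: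
  assumes "1 \<le> k" "k < i" "i \<le> m" "m < n"
  shows "T_run m k * T i = T (i - 1) * T_run m k"
  using assms(3,4)
proof (induction m)
  case 0
  then show ?case using assms by simp
next
  case (Suc m)
  show ?case
  proof (cases "i = Suc m")
    case True
    obtain l where m: "m = Suc l" using True assms by (cases m) auto
    have "T_run l k * T (Suc (Suc l)) = T (Suc (Suc l)) * T_run l k"
      if "Suc (Suc l) < n" for l
      using that
    proof -
      have "T_run l' k * T (Suc (Suc l)) = T (Suc (Suc l)) * T_run l' k" if "l' \<le> l" for l'
        using that
      proof (induction l')
        case (Suc l')
        have "T (Suc l') * T (Suc (Suc l)) = T (Suc (Suc l)) * T (Suc l')"
          using Suc.prems \<open>Suc (Suc l) < n\<close> by (intro TT_far) (auto simp: far_def)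
        thus ?case using Suc by (simp add: mult.assoc) (simp add: mult.assoc[symmetric])
      qed simp
      thus ?thesis by simp
    qed
    hence c: "T_run l k * T (Suc m) = T (Suc m) * T_run l k" using Suc.prems m by simp
    have k: "k \<le> Suc l" using True assms m by simp
    have "T_run (Suc m) k * T i = T (Suc m) * T m * (T_run l k * T (Suc m))"
      using True m k by (simp add: mult.assoc)
    also have "\<dots> = T (Suc m) * T m * T (Suc m) * T_run l k" by (simp add: c mult.assoc)
    also have "T (Suc m) * T m * T (Suc m) = T m * T (Suc m) * T m"
      using Suc.prems m by (intro braid) (auto intro: adjacentI)
    finally show ?thesis using True m k by (simp add: mult.assoc)
  next
    case False
    have "T_run (Suc m) k * T i = T (Suc m) * (T_run m k * T i)"
      using assms Suc.prems by (simp add: mult.assoc)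
    also have "\<dots> = T (Suc m) * T (i - 1) * T_run m k"
      using Suc False by (simp add: mult.assoc)
    also have "T (Suc m) * T (i - 1) = T (i - 1) * T (Suc m)"
      using Suc.prems False assms by (intro TT_far) (auto simp: far_def)
    finally show ?thesis using assms Suc.prems by (simp add: mult.assoc)
  qed
qed

lemma T_run_mult_tie:
  assumes "m < n" "1 \<le> k" "a \<in> {1..n}" "b \<in> {1..n}"
  shows "\<exists>a'\<in>{1..n}. \<exists>b'\<in>{1..n}. T_run m k * tie a b = tie a' b' * T_run m k"
  using assms(1)
proof (induction m)
  case (Suc m)
  show ?case
  proof (cases "k \<le> Suc m")
    case True
    obtain a' b' where ab: "a' \<in> {1..n}" "b' \<in> {1..n}" "T_run m k * tie a b = tie a' b' * T_run m k"
      using Suc by auto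
    have "T_run (Suc m) k * tie a b = T (Suc m) * (tie a' b' * T_run m k)"
      using True ab(3) by (simp add: mult.assoc)
    also have "\<dots> = tie (adj (Suc m) a') (adj (Suc m) b') * T_run (Suc m) k"
      using T_tie[of "Suc m" a' b'] True ab Suc.prems by (simp add: mult.assoc[symmetric])
    finally show ?thesis
      using ab Suc.prems
      by (intro bexI[of _ "adj (Suc m) a'"] bexI[of _ "adj (Suc m) b'"]) (simp_all add: transpose_def)
  next
    case False
    thus ?thesis using assms by (intro bexI[of _ a] bexI[of _ b]) auto
  qed
next
  case 0
  show ?case using assms by (intro bexI[of _ a] bexI[of _ b]) simp_all
qed

lemma T_forms_mult_tie:
  assumes "m < n" "C \<in> T_forms m" "a \<in> {1..n}" "b \<in> {1..n}"
  shows "\<exists>a'\<in>{1..n}. \<exists>b'\<in>{1..n}. C * tie a b = tie a' b' * C"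
  using assms
proof (induction m arbitrary: C a b)
  case (Suc m)
  then obtain D k where C: "C = D * T_run (Suc m) k" "D \<in> T_forms m" "1 \<le> k" by auto
  obtain a' b' where ab: "a' \<in> {1..n}" "b' \<in> {1..n}"
    "T_run (Suc m) k * tie a b = tie a' b' * T_run (Suc m) k"
    using T_run_mult_tie[of "Suc m" k a b] C Suc.prems by blast
  have "m < n" using Suc.prems by simp
  from Suc.IH[OF this C(2) ab(1,2)]
  obtain a2 b2 where ab2: "a2 \<in> {1..n}" "b2 \<in> {1..n}" "D * tie a' b' = tie a2 b2 * D" by blast
  have "C * tie a b = D * tie a' b' * T_run (Suc m) k" using C(1) ab(3) by (simp only: mult.assoc)
  also have "\<dots> = tie a2 b2 * C" by (simp only: ab2(3) C(1) mult.assoc)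
  finally show ?case using ab2(1,2) by blast
next
  case 0
  thus ?case by (intro bexI[of _ a] bexI[of _ b]) simp_all
qed

definition normal_forms :: "nat \<Rightarrow> 'a set" where
  "normal_forms m = {ties xs * C | xs C. edge_list xs \<and> C \<in> T_forms m}"

lemma normal_forms_I: "edge_list xs \<Longrightarrow> C \<in> T_forms m \<Longrightarrow> ties xs * C \<in> normal_forms m"
  unfolding normal_forms_def by blast

lemma normal_forms_E:
  assumes "z \<in> normal_forms m"
  obtains xs C where "z = ties xs * C" "edge_list xs" "C \<in> T_forms m"
  using assms unfolding normal_forms_def by blast

lemma T_forms_Suc_I: "C \<in> T_forms m \<Longrightarrow> 1 \<le> k \<Longrightarrow> k \<le> m + 2 \<Longrightarrow> C * T_run (Suc m) k \<in> T_forms (Suc m)"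
  unfolding T_forms.simps by (intro image_eqI[of _ _ "(C, k)"]) simp_all

lemma T_forms_Suc_E:
  assumes "C \<in> T_forms (Suc m)"
  obtains D k where "C = D * T_run (Suc m) k" "D \<in> T_forms m" "1 \<le> k" "k \<le> m + 2"
  using assms unfolding T_forms.simps by (elim imageE SigmaE) (simp del: T_run.simps)

declare T_forms.simps [simp del] T_run.simps [simp del]

lemma normal_forms_mult_tie:
  assumes "m < n" "x \<in> lspan (normal_forms m)" "a \<in> {1..n}" "b \<in> {1..n}"
  shows "x * tie a b \<in> lspan (normal_forms m)"
  using assms(2)
proof (rule lspan_mult)
  fix y assume "y \<in> normal_forms m"
  then obtain xs C where y: "y = ties xs * C" "edge_list xs" "C \<in> T_forms m" by (rule normal_forms_E)
  obtain a' b' where ab: "a' \<in> {1..n}" "b' \<in> {1..n}" "C * tie a b = tie a' b' * C"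
    using T_forms_mult_tie[OF assms(1) y(3) assms(3,4)] by blast
  have "y * tie a b = ties (xs @ [(a', b')]) * C"
    using ab(3) y(1) by (simp add: mult.assoc)
  moreover have "edge_list (xs @ [(a', b')])" using y(2) ab by simp
  ultimately have "y * tie a b \<in> normal_forms m" using normal_forms_I y(3) by metis
  thus "y * tie a b \<in> lspan (normal_forms m)" by (rule lspan_base)
qed

lemma normal_forms_mult_T_run:
  assumes "x \<in> lspan (normal_forms m)" "1 \<le> k" "k \<le> m + 2"
  shows "x * T_run (Suc m) k \<in> lspan (normal_forms (Suc m))"
  using assms(1)
proof (rule lspan_mult)
  fix y assume "y \<in> normal_forms m"
  then obtain xs C where y: "y = ties xs * C" "edge_list xs" "C \<in> T_forms m" by (rule normal_forms_E)
  have "ties xs * (C * T_run (Suc m) k) \<in> normal_forms (Suc m)"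
    by (intro normal_forms_I y T_forms_Suc_I assms)
  hence "y * T_run (Suc m) k \<in> normal_forms (Suc m)" by (simp only: y(1) mult.assoc)
  thus "y * T_run (Suc m) k \<in> lspan (normal_forms (Suc m))" by (rule lspan_base)
qed

text \<open>
  The index \<open>i\<close> is compared with the end \<open>k\<close> of the last run \<open>T\<^sub>m \<dots> T\<^sub>k\<close>. It passes through the run,
  or prolongs it (\<open>i = k - 1\<close>), or cancels its last factor (\<open>i = k\<close>). What passes
  through is absorbed by the induction hypothesis; in the last case the quadratic relation produces
  ties, which move to the front.
\<close>

lemma normal_forms_mult_T:
  assumes "m < n" "x \<in> lspan (normal_forms m)" "1 \<le> i" "i \<le> m"
  shows "x * T i \<in> lspan (normal_forms m)"
  using assms
proof (induction m arbitrary: x i)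
  case 0
  then show ?case by simp
next
  case (Suc m)
  show ?case using Suc.prems(2)
  proof (rule lspan_mult)
    fix z assume "z \<in> normal_forms (Suc m)"
    then obtain xs C where z: "z = ties xs * C" "edge_list xs" "C \<in> T_forms (Suc m)" by (rule normal_forms_E)
    from z(3) obtain D k where C: "C = D * T_run (Suc m) k" "D \<in> T_forms m" "1 \<le> k" "k \<le> m + 2"
      by (rule T_forms_Suc_E)
    define y where "y = ties xs * D"
    have y: "y \<in> lspan (normal_forms m)" unfolding y_def by (intro lspan_base normal_forms_I z C)
    have zy: "z = y * T_run (Suc m) k" using z C by (simp add: y_def mult.assoc)
    have m: "Suc m < n" using Suc.prems by simp
    consider "Suc i < k" | "k = Suc i" | "i = k" | "k < i" by linarith
    thus "z * T i \<in> lspan (normal_forms (Suc m))"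
    proof cases
      case 1
      have "z * T i = (y * T i) * T_run (Suc m) k"
        using T_run_mult_T_low[OF Suc.prems(3) 1 m] by (simp add: zy mult.assoc)
      moreover have "y * T i \<in> lspan (normal_forms m)" using Suc.IH[OF _ y] 1 C m Suc.prems by simp
      ultimately show ?thesis using normal_forms_mult_T_run C by simp
    next
      case 2
      have "z * T i = y * T_run (Suc m) i"
        using T_run_unfold_right[OF Suc.prems(3,4)] 2 by (simp only: zy mult.assoc)
      thus ?thesis using normal_forms_mult_T_run[OF y] Suc.prems by simp
    next
      case 3
      let ?c = "T_run (Suc m) (Suc k)"
      have r: "k \<in> {1..<n}" "Suc k \<in> {1..n}" "k \<in> {1..n}" using 3 Suc.prems by auto
      have ck: "T_run (Suc m) k = ?c * T k"
        using T_run_unfold_right[of k "Suc m"] 3 Suc.prems by simp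
      have 1: "y * ?c \<in> lspan (normal_forms (Suc m))"
        using 3 Suc.prems by (intro normal_forms_mult_T_run[OF y]) auto
      obtain a b where ab: "a \<in> {1..n}" "b \<in> {1..n}" "?c * E k = tie a b * ?c"
        using T_run_mult_tie[OF m, of "Suc k" k "Suc k"] r by (auto simp: tie_Suc)
      have e: "y * tie a b \<in> lspan (normal_forms m)" using normal_forms_mult_tie[OF _ y ab(1,2)] m by simp
      have 2: "y * tie a b * ?c \<in> lspan (normal_forms (Suc m))" "y * tie a b * T_run (Suc m) k \<in> lspan (normal_forms (Suc m))"
        using 3 Suc.prems C by (auto intro!: normal_forms_mult_T_run[OF e] simp del: T_run.simps)
      \<comment> \<open>The last factor \<open>T k\<close> of the run is split off; the tie that the quadratic relation puts
        behind the rest \<open>?c\<close> of the run moves in front of it.\<close>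
      have "z * T i = y * (?c * (T k * T k))"
        using 3 by (simp only: zy ck mult.assoc)
      also have "?c * (T k * T k) = ?c + \<iota> (q - 1) * (?c * E k) + \<iota> (q - 1) * (?c * E k * T k)"
        unfolding quad[OF r(1)] by (simp only: distrib_left mult_1_right mult.assoc[symmetric] \<iota>_central add.assoc)
      also have "\<dots> = ?c + \<iota> (q - 1) * (tie a b * ?c) + \<iota> (q - 1) * (tie a b * T_run (Suc m) k)"
        by (simp only: ab(3) ck mult.assoc)
      also have "y * \<dots> = y * ?c + \<iota> (q - 1) * (y * tie a b * ?c) + \<iota> (q - 1) * (y * tie a b * T_run (Suc m) k)"
        by (simp only: distrib_left mult.assoc[symmetric] \<iota>_central)
      finally show ?thesis using 1 2 by (simp only: lspan_add lspan_scale)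
    next
      case 4
      have "z * T i = (y * T (i - 1)) * T_run (Suc m) k"
        using T_run_mult_T_high[OF C(3) 4 Suc.prems(4) m] by (simp only: zy mult.assoc)
      moreover have "y * T (i - 1) \<in> lspan (normal_forms m)"
        using Suc.IH[OF _ y, of "i - 1"] 4 C m Suc.prems by simp
      ultimately show ?thesis using normal_forms_mult_T_run C by simp
    qed
  qed
qed

text \<open>
  The subalgebra generated by the \<open>T\<^sub>i\<close> and \<open>E\<^sub>i\<close>, built up by multiplication from the right.
\<close>

inductive_set generated :: "'a set" where
  one: "1 \<in> generated"
| T: "x \<in> generated \<Longrightarrow> i \<in> {1..<n} \<Longrightarrow> x * T i \<in> generated"
| E: "x \<in> generated \<Longrightarrow> i \<in> {1..<n} \<Longrightarrow> x * E i \<in> generated"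
| scale: "x \<in> generated \<Longrightarrow> \<iota> c * x \<in> generated"
| add: "x \<in> generated \<Longrightarrow> y \<in> generated \<Longrightarrow> x + y \<in> generated"

lemma one_normal_forms: "1 \<in> normal_forms m"
proof -
  have "1 \<in> T_forms m"
  proof (induction m)
    case (Suc m)
    show ?case using T_forms_Suc_I[OF Suc, of "m + 2"] by (simp add: T_run.simps)
  qed (simp add: T_forms.simps)
  hence "ties [] * 1 \<in> normal_forms m" by (intro normal_forms_I) simp_all
  thus ?thesis by simp
qed

text \<open>
  The span of the normal forms contains \<open>1\<close> and is closed under the operations that build up the
  generated subalgebra. Its size is bounded by the number of partitions times the number of products
  of runs.
\<close>

theorem generated_spanned:
  "\<exists>B. finite B \<and> card B \<le> fact n * card {P. partition_on {1..n} P} \<and> generated \<subseteq> lspan B"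
proof -
  have span: "x \<in> lspan (normal_forms (n - 1))" if "x \<in> generated" for x
    using that
  proof (induction rule: generated.induct)
    case one
    show ?case by (intro lspan_base one_normal_forms)
  next
    case (T x i)
    then show ?case by (intro normal_forms_mult_T) auto
  next
    case (E x i)
    then show ?case using normal_forms_mult_tie[of "n - 1" x i "Suc i"] by (auto simp: tie_Suc)
  qed (auto intro: lspan_add lspan_scale)
  let ?P = "{P. partition_on {1..n} P}"
  let ?I = "(\<lambda>(P, C). partition_idem P * C) ` (?P \<times> T_forms (n - 1))"
  have fin: "finite ?P" by (rule finitely_many_partition_on) simp
  have "normal_forms (n - 1) \<subseteq> ?I"
  proof
    fix z assume "z \<in> normal_forms (n - 1)"
    then obtain xs C where z: "z = ties xs * C" "edge_list xs" "C \<in> T_forms (n - 1)" by (rule normal_forms_E)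
    then obtain P where "partition_on {1..n} P" "ties xs = partition_idem P"
      using ties_eq_partition_idem by blast
    thus "z \<in> ?I" using z by (intro image_eqI[of _ _ "(P, C)"]) simp_all
  qed
  moreover have I: "finite ?I" using fin card_T_forms by simp
  moreover have "card (T_forms (n - 1)) \<le> fact n"
    using card_T_forms(2)[of "n - 1"] by (cases n) auto
  hence "card (?P \<times> T_forms (n - 1)) \<le> fact n * card ?P"
    by (simp add: card_cartesian_product mult.commute)
  hence "card ?I \<le> fact n * card ?P"
    using card_image_le[of "?P \<times> T_forms (n - 1)" "\<lambda>(P, C). partition_idem P * C"] fin card_T_forms
    by (meson finite_SigmaI le_trans)
  ultimately have "finite (normal_forms (n - 1))" "card (normal_forms (n - 1)) \<le> fact n * card ?P"
    using card_mono[OF I] finite_subset by (blast, meson le_trans)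
  thus ?thesis using span by blast
qed

end

section \<open>The free algebra and the defining ideal\<close>

lemma poly_mapping_sum_single:
  fixes p :: "'b \<Rightarrow>\<^sub>0 'c::comm_monoid_add"
  shows "p = (\<Sum>k\<in>Poly_Mapping.keys p. Poly_Mapping.single k (Poly_Mapping.lookup p k))"
proof (rule poly_mapping_eqI)
  fix k
  have "Poly_Mapping.lookup (\<Sum>j\<in>Poly_Mapping.keys p. Poly_Mapping.single j (Poly_Mapping.lookup p j)) k
      = (\<Sum>j\<in>Poly_Mapping.keys p. if j = k then Poly_Mapping.lookup p j else 0)"
    by (simp add: lookup_sum lookup_single when_def)
  also have "\<dots> = Poly_Mapping.lookup p k" by (simp add: in_keys_iff)
  finally show "Poly_Mapping.lookup p k = Poly_Mapping.lookup (\<Sum>j\<in>Poly_Mapping.keys p.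
      Poly_Mapping.single j (Poly_Mapping.lookup p j)) k" by simp
qed

lemma poly_mapping_keys_induct [consumes 1, case_names zero single]:
  fixes p :: "'b \<Rightarrow>\<^sub>0 'c::comm_monoid_add"
  assumes "Poly_Mapping.keys p \<subseteq> A"
    and "P 0"
    and "\<And>k a p. k \<in> A \<Longrightarrow> Poly_Mapping.keys p \<subseteq> A \<Longrightarrow> P p \<Longrightarrow> P (Poly_Mapping.single k a + p)"
  shows "P p"
proof -
  have "P (\<Sum>k\<in>K. Poly_Mapping.single k (Poly_Mapping.lookup p k)) \<and>
    Poly_Mapping.keys (\<Sum>k\<in>K. Poly_Mapping.single k (Poly_Mapping.lookup p k)) \<subseteq> A"
    if "finite K" "K \<subseteq> A" for K
    using that
  proof (induction K rule: finite_induct)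
    case (insert k K)
    let ?s = "\<Sum>k\<in>K. Poly_Mapping.single k (Poly_Mapping.lookup p k)"
    have "Poly_Mapping.keys (Poly_Mapping.single k (Poly_Mapping.lookup p k) + ?s) \<subseteq> A"
      using insert keys_add[of "Poly_Mapping.single k (Poly_Mapping.lookup p k)" ?s] by (auto split: if_splits)
    then show ?case using insert assms(3) by simp
  qed (simp add: assms(2))
  from this[of "Poly_Mapping.keys p"] assms(1) poly_mapping_sum_single[of p] show ?thesis by simp
qed

lemma scale_eq_mult: "scale a p = Poly_Mapping.single 0 a * p"
  by (simp add: scale_def mult_map_scale_conv_mult)

lemma single_0_commute:
  fixes p :: "'w::monoid_add \<Rightarrow>\<^sub>0 'r::comm_semiring_1"
  shows "p * Poly_Mapping.single 0 a = Poly_Mapping.single 0 a * p"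
proof -
  have "Poly_Mapping.keys p \<subseteq> UNIV" by simp
  thus ?thesis
    by (induction rule: poly_mapping_keys_induct)
       (simp_all add: distrib_left distrib_right mult_single mult.commute)
qed

definition bt_letters :: "nat \<Rightarrow> bt_gen set" where
  "bt_letters n = T_gen ` {1..<n} \<union> E_gen ` {1..<n}"

definition bt_elems :: "nat \<Rightarrow> bt_free set" where
  "bt_elems n = {p. Poly_Mapping.keys p \<subseteq> {w. set (letters w) \<subseteq> bt_letters n}}"

lemma bt_free_algebra_simps [simp]:
  "carrier (bt_free_algebra n) = bt_elems n" "monoid.mult (bt_free_algebra n) = (*)"
  "monoid.one (bt_free_algebra n) = 1" "ring.zero (bt_free_algebra n) = 0"
  "ring.add (bt_free_algebra n) = (+)" "(\<odot>\<^bsub>bt_free_algebra n\<^esub>) = scale"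
  by (auto simp: bt_free_algebra_def free_algebra_def bt_elems_def bt_letters_def)

lemma bt_elems_0 [simp]: "0 \<in> bt_elems n"
  by (simp add: bt_elems_def)

lemma bt_elems_single: "set (letters w) \<subseteq> bt_letters n \<Longrightarrow> Poly_Mapping.single w a \<in> bt_elems n"
  by (auto simp: bt_elems_def)

lemma bt_elems_1 [simp]: "1 \<in> bt_elems n"
proof -
  have "Poly_Mapping.single 0 1 \<in> bt_elems n" by (rule bt_elems_single) (simp add: zero_word_def)
  thus ?thesis by simp
qed

lemma bt_elems_scalar [simp]: "Poly_Mapping.single 0 a \<in> bt_elems n"
  by (rule bt_elems_single) (simp add: zero_word_def)

lemma bt_elems_add [simp]: "p \<in> bt_elems n \<Longrightarrow> q \<in> bt_elems n \<Longrightarrow> p + q \<in> bt_elems n"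
  unfolding bt_elems_def using keys_add[of p q] by auto

lemma bt_elems_uminus [simp]: "p \<in> bt_elems n \<Longrightarrow> - p \<in> bt_elems n"
  by (simp add: bt_elems_def keys_def)

lemma bt_elems_diff [simp]: "p \<in> bt_elems n \<Longrightarrow> q \<in> bt_elems n \<Longrightarrow> p - q \<in> bt_elems n"
  using bt_elems_add[of p n "- q"] by simp

lemma bt_elems_mult [simp]:
  assumes "p \<in> bt_elems n" "q \<in> bt_elems n"
  shows "p * q \<in> bt_elems n"
proof -
  have "set (letters w) \<subseteq> bt_letters n" if w: "w \<in> Poly_Mapping.keys (p * q)" for w
  proof -
    obtain v v' where "w = v + v'" "v \<in> Poly_Mapping.keys p" "v' \<in> Poly_Mapping.keys q"
      using keys_mult[of p q] w by blast
    thus ?thesis using assms by (fastforce simp: plus_word_def bt_elems_def)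
  qed
  thus ?thesis by (auto simp: bt_elems_def)
qed

lemma bt_elems_scale [simp]: "p \<in> bt_elems n \<Longrightarrow> scale a p \<in> bt_elems n"
  by (simp add: scale_eq_mult)

lemma bt_elems_T [simp]: "i \<in> {1..<n} \<Longrightarrow> bt_T i \<in> bt_elems n"
  unfolding bt_T_def by (rule bt_elems_single) (simp add: bt_letters_def)

lemma bt_elems_E [simp]: "i \<in> {1..<n} \<Longrightarrow> bt_E i \<in> bt_elems n"
  unfolding bt_E_def by (rule bt_elems_single) (simp add: bt_letters_def)

lemma bt_elems_power [simp]: "p \<in> bt_elems n \<Longrightarrow> p ^ k \<in> bt_elems n"
  by (induction k) auto

lemma ring_bt_free_algebra: "ring (bt_free_algebra n)"
proof (rule ringI)
  show "abelian_group (bt_free_algebra n)"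
  proof (rule abelian_groupI)
    fix x assume "x \<in> carrier (bt_free_algebra n)"
    thus "\<exists>y\<in>carrier (bt_free_algebra n). y \<oplus>\<^bsub>bt_free_algebra n\<^esub> x = \<zero>\<^bsub>bt_free_algebra n\<^esub>"
      by (intro bexI[of _ "- x"]) auto
  qed (auto simp: add.assoc add.commute)
  show "monoid (bt_free_algebra n)"
    by (rule monoidI) (auto simp: mult.assoc)
qed (auto simp: distrib_left distrib_right)

lemma bt_rel_elems: "bt_rel n x y \<Longrightarrow> x \<in> bt_elems n \<and> y \<in> bt_elems n"
  by (induction rule: bt_rel.induct) (auto simp del: atLeastLessThan_iff)

lemma bt_ideal_is_ideal: "ideal (bt_ideal n) (bt_free_algebra n)"
  unfolding bt_ideal_def
  by (rule ring.genideal_ideal[OF ring_bt_free_algebra]) (auto dest: bt_rel_elems)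

lemma bt_ideal_least:
  assumes "ideal J (bt_free_algebra n)" "\<And>x y. bt_rel n x y \<Longrightarrow> x - y \<in> J"
  shows "bt_ideal n \<subseteq> J"
  unfolding bt_ideal_def
  by (rule ring.genideal_minimal[OF ring_bt_free_algebra assms(1)]) (auto intro: assms(2))

lemma bt_ideal_elems: "x \<in> bt_ideal n \<Longrightarrow> x \<in> bt_elems n"
  using ideal.Icarr[OF bt_ideal_is_ideal] by simp

lemma bt_ideal_0 [simp]: "0 \<in> bt_ideal n"
  using additive_subgroup.zero_closed[OF ideal.axioms(1)[OF bt_ideal_is_ideal]] by simp

lemma bt_ideal_add: "x \<in> bt_ideal n \<Longrightarrow> y \<in> bt_ideal n \<Longrightarrow> x + y \<in> bt_ideal n"
  using additive_subgroup.a_closed[OF ideal.axioms(1)[OF bt_ideal_is_ideal]] by fastforce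

lemma bt_ideal_mult:
  assumes "x \<in> bt_elems n" "y \<in> bt_ideal n"
  shows "x * y \<in> bt_ideal n" "y * x \<in> bt_ideal n"
  using ideal.I_l_closed[OF bt_ideal_is_ideal, of y n x] ideal.I_r_closed[OF bt_ideal_is_ideal, of y n x]
    assms by auto

lemma bt_ideal_uminus: "x \<in> bt_ideal n \<Longrightarrow> - x \<in> bt_ideal n"
  using bt_ideal_mult(1)[of "- 1" n x] by simp

lemma bt_ideal_rel: "bt_rel n x y \<Longrightarrow> x - y \<in> bt_ideal n"
proof -
  assume "bt_rel n x y"
  moreover have "{x - y | x y. bt_rel n x y} \<subseteq> bt_ideal n"
    unfolding bt_ideal_def
    by (rule ring.genideal_self[OF ring_bt_free_algebra]) (auto dest: bt_rel_elems)
  ultimately show ?thesis by blast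
qed

text \<open>
  Equality in the quotient algebra, for elements of the free algebra.
\<close>

definition cong_bt :: "nat \<Rightarrow> bt_free \<Rightarrow> bt_free \<Rightarrow> bool" where
  "cong_bt n p q \<longleftrightarrow> p \<in> bt_elems n \<and> q \<in> bt_elems n \<and> p - q \<in> bt_ideal n"

lemma cong_bt_refl: "p \<in> bt_elems n \<Longrightarrow> cong_bt n p p"
  by (simp add: cong_bt_def)

lemma cong_bt_sym: "cong_bt n p q \<Longrightarrow> cong_bt n q p"
  using bt_ideal_uminus[of "p - q" n] by (simp add: cong_bt_def)

lemma cong_bt_trans: "cong_bt n p q \<Longrightarrow> cong_bt n q r \<Longrightarrow> cong_bt n p r"
  using bt_ideal_add[of "p - q" n "q - r"] by (simp add: cong_bt_def)

lemma cong_bt_add: "cong_bt n p q \<Longrightarrow> cong_bt n p' q' \<Longrightarrow> cong_bt n (p + p') (q + q')"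
  using bt_ideal_add[of "p - q" n "p' - q'"] by (simp add: cong_bt_def algebra_simps)

lemma cong_bt_uminus: "cong_bt n p q \<Longrightarrow> cong_bt n (- p) (- q)"
  using bt_ideal_uminus[of "p - q" n] by (simp add: cong_bt_def)

lemma cong_bt_mult:
  assumes "cong_bt n p q" "cong_bt n p' q'"
  shows "cong_bt n (p * p') (q * q')"
proof -
  have "p * (p' - q') + (p - q) * q' \<in> bt_ideal n"
    using assms unfolding cong_bt_def by (intro bt_ideal_add bt_ideal_mult) auto
  thus ?thesis using assms by (simp add: cong_bt_def algebra_simps)
qed

lemma cong_bt_rel: "bt_rel n p q \<Longrightarrow> cong_bt n p q"
  by (simp add: cong_bt_def bt_rel_elems bt_ideal_rel)

section \<open>All the quotient algebras in one ring\<close>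

text \<open>
  Families of elements, the \<open>n\<close>-th one in the free algebra for \<open>n\<close>, are compared in every component.
  As not every function is such a family, this is a partial equivalence relation, and its quotient
  is the product of the quotient algebras over all \<open>n\<close>.
\<close>

definition cong_family :: "(nat \<Rightarrow> bt_free) \<Rightarrow> (nat \<Rightarrow> bt_free) \<Rightarrow> bool" where
  "cong_family f g \<longleftrightarrow> (\<forall>n. cong_bt n (f n) (g n))"

text \<open>
  Lifting has to stop at polynomials instead of unfolding them into functions.
\<close>

lifting_forget poly_mapping.lifting

quotient_type bt_family = "nat \<Rightarrow> bt_free" / partial: cong_family
  unfolding cong_family_def
proof (rule part_equivpI)
  show "\<exists>f. \<forall>n. cong_bt n (f n) (f n)"
    by (rule exI[of _ "\<lambda>_. 0"]) (simp add: cong_bt_refl)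
  show "symp (\<lambda>f g. \<forall>n. cong_bt n (f n) (g n))"
    by (auto simp: symp_def intro: cong_bt_sym)
  show "transp (\<lambda>f g. \<forall>n. cong_bt n (f n) (g n))"
    unfolding transp_def using cong_bt_trans by blast
qed

instantiation bt_family :: "{ring, monoid_mult}"
begin

lift_definition zero_bt_family :: bt_family is "\<lambda>_. 0" by (simp add: cong_family_def cong_bt_refl)
lift_definition one_bt_family :: bt_family is "\<lambda>_. 1" by (simp add: cong_family_def cong_bt_refl)
lift_definition plus_bt_family :: "bt_family \<Rightarrow> bt_family \<Rightarrow> bt_family" is
  "\<lambda>f g n. f n + g n" by (simp add: cong_family_def cong_bt_add)
lift_definition uminus_bt_family :: "bt_family \<Rightarrow> bt_family" is
  "\<lambda>f n. - f n" by (simp add: cong_family_def cong_bt_uminus)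
lift_definition minus_bt_family :: "bt_family \<Rightarrow> bt_family \<Rightarrow> bt_family" is
  "\<lambda>f g n. f n + - g n" unfolding cong_family_def by (intro allI cong_bt_add cong_bt_uminus) auto
lift_definition times_bt_family :: "bt_family \<Rightarrow> bt_family \<Rightarrow> bt_family" is
  "\<lambda>f g n. f n * g n" by (simp add: cong_family_def cong_bt_mult)

instance
proof
  fix a b c :: bt_family
  show "a + b + c = a + (b + c)"
    by transfer (auto simp: cong_family_def cong_bt_def add.assoc)
  show "a + b = b + a"
    by transfer (auto simp: cong_family_def cong_bt_def add.commute)
  show "0 + a = a"
    by transfer (auto simp: cong_family_def cong_bt_def)
  show "- a + a = 0"
    by transfer (auto simp: cong_family_def cong_bt_def)
  show "a - b = a + - b"
    by transfer (auto simp: cong_family_def cong_bt_def)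
  show "a * b * c = a * (b * c)"
    by transfer (auto simp: cong_family_def cong_bt_def mult.assoc)
  show "(a + b) * c = a * c + b * c"
    by transfer (auto simp: cong_family_def cong_bt_def distrib_right)
  show "a * (b + c) = a * b + a * c"
    by transfer (auto simp: cong_family_def cong_bt_def distrib_left)
  show "1 * a = a" "a * 1 = a"
    by (transfer, auto simp: cong_family_def cong_bt_def)+
qed

end

text \<open>
  The generators of the algebra for \<open>n\<close> as members of the product ring. In the components \<open>m \<noteq> n\<close>
  they are replaced by \<open>T\<^sub>i = 1\<close> and \<open>E\<^sub>i = 0\<close>, which satisfy all relations too, so that the relations
  hold as equations of the product ring.
\<close>

lift_definition fam_T :: "nat \<Rightarrow> nat \<Rightarrow> bt_family" is
  "\<lambda>n i m. if m = n \<and> i \<in> {1..<n} then bt_T i else 1"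
  by (auto simp: cong_family_def intro!: cong_bt_refl simp del: atLeastLessThan_iff)

lift_definition fam_E :: "nat \<Rightarrow> nat \<Rightarrow> bt_family" is
  "\<lambda>n i m. if m = n \<and> i \<in> {1..<n} then bt_E i else 0"
  by (auto simp: cong_family_def intro!: cong_bt_refl simp del: atLeastLessThan_iff)

lift_definition fam_scalar :: "laurent \<Rightarrow> bt_family" is
  "\<lambda>a m. Poly_Mapping.single 0 a"
  by (simp add: cong_family_def cong_bt_refl)

text \<open>
  A relation between a member of the product ring and the polynomials that represent its component
  \<open>n\<close>; it spares a choice among them.
\<close>

lift_definition fam_comp :: "nat \<Rightarrow> bt_family \<Rightarrow> bt_free \<Rightarrow> bool" is
  "\<lambda>n f p. cong_bt n (f n) p"
  unfolding cong_family_def fun_eq_iff by (meson cong_bt_sym cong_bt_trans)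

definition laurent_u_inv :: laurent where
  "laurent_u_inv = Poly_Mapping.single (-1) 1"

lemma laurent_u_inverse: "laurent_u * laurent_u_inv = 1"
  by (simp add: laurent_u_def laurent_u_inv_def mult_single)

lemma fam_comp_ex: "\<exists>p. fam_comp n x p"
  by transfer (auto simp: cong_family_def)

lemma fam_comp_elems: "fam_comp n x p \<Longrightarrow> p \<in> bt_elems n"
  by transfer (simp add: cong_family_def cong_bt_def)

lemma fam_comp_unique: "fam_comp n x p \<Longrightarrow> fam_comp n x q \<Longrightarrow> cong_bt n p q"
  by transfer (meson cong_family_def cong_bt_sym cong_bt_trans)

lemma fam_comp_one: "fam_comp n 1 1"
  by transfer (simp add: cong_family_def cong_bt_refl)

lemma fam_comp_zero: "fam_comp n 0 0"
  by transfer (simp add: cong_family_def cong_bt_refl)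

lemma fam_comp_add: "fam_comp n x p \<Longrightarrow> fam_comp n y q \<Longrightarrow> fam_comp n (x + y) (p + q)"
  by transfer (simp add: cong_family_def cong_bt_add)

lemma fam_comp_mult: "fam_comp n x p \<Longrightarrow> fam_comp n y q \<Longrightarrow> fam_comp n (x * y) (p * q)"
  by transfer (simp add: cong_family_def cong_bt_mult)

lemma fam_comp_scalar: "fam_comp n (fam_scalar a) (Poly_Mapping.single 0 a)"
  by transfer (simp add: cong_bt_refl)

lemma fam_comp_scale: "fam_comp n x p \<Longrightarrow> fam_comp n (fam_scalar a * x) (scale a p)"
  unfolding scale_eq_mult by (intro fam_comp_mult fam_comp_scalar)

lemma fam_comp_T: "i \<in> {1..<n} \<Longrightarrow> fam_comp n (fam_T n i) (bt_T i)"
  by (transfer fixing: n i) (auto simp del: atLeastLessThan_iff intro: cong_bt_refl)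

lemma fam_comp_E: "i \<in> {1..<n} \<Longrightarrow> fam_comp n (fam_E n i) (bt_E i)"
  by (transfer fixing: n i) (auto simp del: atLeastLessThan_iff intro: cong_bt_refl)

lemma fam_comp_T_other: "m \<noteq> n \<Longrightarrow> fam_comp m (fam_T n i) 1"
  by (transfer fixing: m n i) (auto intro: cong_bt_refl)

lemma fam_comp_E_other: "m \<noteq> n \<Longrightarrow> fam_comp m (fam_E n i) 0"
  by (transfer fixing: m n i) (auto intro: cong_bt_refl)

lemma fam_eqI:
  assumes "\<forall>m. \<exists>p q. fam_comp m x p \<and> fam_comp m y q \<and> cong_bt m p q"
  shows "x = y"
  using assms by transfer (unfold cong_family_def, meson cong_bt_sym cong_bt_trans)

lemma fam_rel_eqI:
  assumes "bt_rel n p q" "fam_comp n x p" "fam_comp n y q"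
    and "\<And>m. m \<noteq> n \<Longrightarrow> \<exists>r. fam_comp m x r \<and> fam_comp m y r"
  shows "x = y"
proof (rule fam_eqI, rule allI)
  fix m
  show "\<exists>p q. fam_comp m x p \<and> fam_comp m y q \<and> cong_bt m p q"
    using assms cong_bt_rel[OF assms(1)] cong_bt_refl fam_comp_elems by (cases "m = n") blast+
qed

interpretation fam: braids_and_ties n "fam_T n" "fam_E n" fam_scalar laurent_u laurent_u_inv for n
proof
  show "laurent_u * laurent_u_inv = 1" by (rule laurent_u_inverse)
  fix a b :: laurent and x :: bt_family
  show "fam_scalar (a + b) = fam_scalar a + fam_scalar b"
    by transfer (simp add: single_add cong_bt_refl cong_family_def)
  show "fam_scalar (a * b) = fam_scalar a * fam_scalar b"
    by transfer (simp add: mult_single cong_bt_refl cong_family_def)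
  show "fam_scalar 1 = 1"
    by transfer (simp add: cong_bt_refl cong_family_def)
  show "x * fam_scalar a = fam_scalar a * x"
    by transfer (simp add: single_0_commute cong_bt_def cong_family_def)
next
  note comps = fam_comp_mult fam_comp_T fam_comp_E
  have TT: "fam_comp m (fam_T n i * fam_T n j) 1" if "m \<noteq> n" for m i j
    using fam_comp_mult[OF fam_comp_T_other[OF that] fam_comp_T_other[OF that]] by simp
  have E0: "fam_comp m (fam_E n i * x) 0" "fam_comp m (x * fam_E n i) 0" if "m \<noteq> n" for m i x
    using fam_comp_mult[OF fam_comp_E_other[OF that], of x] fam_comp_mult[OF _ fam_comp_E_other[OF that], of x]
      fam_comp_ex[of m x] by auto
  have E1: "fam_comp m (fam_E n i * x * y) 0" if "m \<noteq> n" for m i x y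
    using E0(1)[OF that, of i "x * y"] by (simp add: mult.assoc)
  fix i j assume ij: "i \<in> {1..<n}" "j \<in> {1..<n}"
  show "fam_E n i * fam_E n j = fam_E n j * fam_E n i"
    by (rule fam_rel_eqI[OF E_E[OF ij]]) (use ij in \<open>blast intro: comps E0\<close>)+
  show "fam_T n i * fam_T n j = fam_T n j * fam_T n i" if "far i j"
    by (rule fam_rel_eqI[OF T_T_far[OF ij that]]) (use ij in \<open>blast intro: comps TT\<close>)+
  show "fam_E n i * fam_T n j = fam_T n j * fam_E n i" if "far i j"
    by (rule fam_rel_eqI[OF E_T_far[OF ij that]]) (use ij in \<open>blast intro: comps E0\<close>)+
  show "fam_E n i * fam_E n i = fam_E n i"
    by (rule fam_rel_eqI[OF E_idem[OF ij(1)]], unfold power2_eq_square)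
       (use ij in \<open>blast intro: comps E0 fam_comp_E_other\<close>)+
  show "fam_E n i * fam_T n i = fam_T n i * fam_E n i"
    by (rule fam_rel_eqI[OF E_T_same[OF ij(1)]]) (use ij in \<open>blast intro: comps E0\<close>)+
  show "fam_T n i * fam_T n i = 1 + fam_scalar (laurent_u - 1) * (fam_E n i * (1 + fam_T n i))"
  proof (rule fam_rel_eqI[OF quadratic[OF ij(1)]], unfold power2_eq_square)
    show "fam_comp n (fam_T n i * fam_T n i) (bt_T i * bt_T i)"
      by (intro comps ij)
    show "fam_comp n (1 + fam_scalar (laurent_u - 1) * (fam_E n i * (1 + fam_T n i)))
        (1 + scale (laurent_u - 1) (bt_E i * (1 + bt_T i)))"
      by (intro fam_comp_add fam_comp_scale comps ij fam_comp_one)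
    fix m assume m: "m \<noteq> n"
    have "fam_comp m (1 + fam_scalar (laurent_u - 1) * (fam_E n i * (1 + fam_T n i))) (1 + scale (laurent_u - 1) 0)"
      by (intro fam_comp_add fam_comp_scale E0 m fam_comp_one)
    hence "fam_comp m (1 + fam_scalar (laurent_u - 1) * (fam_E n i * (1 + fam_T n i))) 1"
      by (simp add: scale_eq_mult)
    thus "\<exists>r. fam_comp m (fam_T n i * fam_T n i) r \<and>
        fam_comp m (1 + fam_scalar (laurent_u - 1) * (fam_E n i * (1 + fam_T n i))) r"
      using TT[OF m] by blast
  qed
  assume a: "adjacent i j"
  have TTT: "fam_comp m (fam_T n i * fam_T n j * fam_T n k) 1" if "m \<noteq> n" for m i j k
    using fam_comp_mult[OF TT[OF that] fam_comp_T_other[OF that]] by simp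
  show "fam_T n i * fam_T n j * fam_T n i = fam_T n j * fam_T n i * fam_T n j"
    by (rule fam_rel_eqI[OF bt_rel.braid[OF ij a]]) (use ij in \<open>blast intro: comps TTT\<close>)+
  show "fam_E n j * fam_T n i * fam_T n j = fam_T n i * fam_T n j * fam_E n i"
    by (rule fam_rel_eqI[OF E_T_T[OF ij a]]) (use ij in \<open>blast intro: comps E0 E1\<close>)+
  show "fam_E n i * fam_E n j * fam_T n j = fam_E n i * fam_T n j * fam_E n i"
    by (rule fam_rel_eqI[OF E_E_T[OF ij a]]) (use ij in \<open>blast intro: comps E0 E1\<close>)+
  show "fam_E n i * fam_T n j * fam_E n i = fam_T n j * fam_E n i * fam_E n j"
    by (rule fam_rel_eqI[OF E_T_E[OF ij a]]) (use ij in \<open>blast intro: comps E0 E1\<close>)+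
qed

lemma fam_comp_sum:
  "finite B \<Longrightarrow> (\<And>b. b \<in> B \<Longrightarrow> fam_comp n (f b) (g b)) \<Longrightarrow> fam_comp n (sum f B) (sum g B)"
  by (induction B rule: finite_induct) (auto intro: fam_comp_zero fam_comp_add)

lemma ex_generated_word:
  assumes "set l \<subseteq> bt_letters n"
  shows "\<exists>x\<in>fam.generated n. fam_comp n x (Poly_Mapping.single (Word l) 1)"
  using assms
proof (induction l rule: rev_induct)
  case Nil
  show ?case using fam_comp_one fam.generated.one by (metis single_one zero_word_def)
next
  case (snoc g l)
  then obtain x where x: "x \<in> fam.generated n" "fam_comp n x (Poly_Mapping.single (Word l) 1)" by auto
  have w: "Poly_Mapping.single (Word (l @ [g])) 1
      = (Poly_Mapping.single (Word l) 1 * Poly_Mapping.single (Word [g]) 1 :: bt_free)"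
    by (simp add: mult_single plus_word_def)
  from snoc.prems consider i where "g = T_gen i" "i \<in> {1..<n}" | i where "g = E_gen i" "i \<in> {1..<n}"
    by (auto simp: bt_letters_def)
  thus ?case
  proof cases
    case 1
    show ?thesis unfolding w
      using fam.generated.T[OF x(1) 1(2)] fam_comp_mult[OF x(2) fam_comp_T[OF 1(2)]] 1(1)
      unfolding bt_T_def by blast
  next
    case 2
    show ?thesis unfolding w
      using fam.generated.E[OF x(1) 2(2)] fam_comp_mult[OF x(2) fam_comp_E[OF 2(2)]] 2(1)
      unfolding bt_E_def by blast
  qed
qed

text \<open>
  Every element of the free algebra for \<open>n\<close> is the component \<open>n\<close> of a member of the generated
  subalgebra, so that the spanning set of the subalgebra can be pulled back.
\<close>

lemma ex_generated:
  assumes "p \<in> bt_elems n"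
  shows "\<exists>x\<in>fam.generated n. fam_comp n x p"
proof -
  have "Poly_Mapping.keys p \<subseteq> {w. set (letters w) \<subseteq> bt_letters n}"
    using assms by (simp add: bt_elems_def)
  thus ?thesis
  proof (induction rule: poly_mapping_keys_induct)
    case zero
    have "fam_scalar 0 * 1 \<in> fam.generated n" by (intro fam.generated.scale fam.generated.one)
    thus ?case using fam_comp_zero by (auto simp: fam.\<iota>_0)
  next
    case (single w a p)
    then obtain x where x: "x \<in> fam.generated n" "fam_comp n x p" by blast
    obtain y where y: "y \<in> fam.generated n" "fam_comp n y (Poly_Mapping.single w 1)"
      using ex_generated_word[of "letters w" n] single by auto
    have s: "scale a (Poly_Mapping.single w 1) = (Poly_Mapping.single w a :: bt_free)"
      by (simp add: scale_eq_mult mult_single)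
    show ?case
      using fam.generated.add[OF fam.generated.scale[OF y(1), of a] x(1)]
        fam_comp_add[OF fam_comp_scale[OF y(2), of a] x(2)] unfolding s by blast
  qed
qed

theorem bt_spanning:
  "\<exists>(B :: bt_family set) g. finite B \<and> card B \<le> fact n * bell n \<and> g ` B \<subseteq> bt_elems n \<and>
     (\<forall>p\<in>bt_elems n. \<exists>c. cong_bt n p (\<Sum>b\<in>B. scale (c b) (g b)))"
proof -
  obtain B where B: "finite B" "card B \<le> fact n * bell n" "fam.generated n \<subseteq> fam.lspan B"
    using fam.generated_spanned[of n] by (auto simp: bell_def)
  define g where "g b = (SOME p. fam_comp n b p)" for b
  have g: "fam_comp n b (g b)" for b
    unfolding g_def by (rule someI_ex) (rule fam_comp_ex)
  have "\<exists>c. cong_bt n p (\<Sum>b\<in>B. scale (c b) (g b))" if p: "p \<in> bt_elems n" for p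
  proof -
    obtain x where x: "x \<in> fam.generated n" "fam_comp n x p" using ex_generated[OF p] by blast
    obtain c where c: "x = (\<Sum>b\<in>B. fam_scalar (c b) * b)"
      using fam.lspan_finite[OF B(1), of x] B(3) x(1) by blast
    have "fam_comp n x (\<Sum>b\<in>B. scale (c b) (g b))"
      unfolding c by (intro fam_comp_sum B(1) fam_comp_scale g)
    thus ?thesis using fam_comp_unique[OF x(2)] by blast
  qed
  thus ?thesis using B g fam_comp_elems by (intro exI[of _ B] exI[of _ g]) blast
qed

section \<open>Laurent polynomials as rational functions\<close>

definition const_ratfun :: "complex \<Rightarrow> ratfun" where
  "const_ratfun c = Fract [:c:] 1"

lemma const_ratfun_simps [simp]:
  "const_ratfun 0 = 0" "const_ratfun 1 = 1"
  "const_ratfun (a + b) = const_ratfun a + const_ratfun b"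
  "const_ratfun (a * b) = const_ratfun a * const_ratfun b"
  by (simp_all add: const_ratfun_def fract_collapse pCons_one mult.commute)

lemma ratfun_u_nonzero: "ratfun_u \<noteq> 0"
  by (simp add: ratfun_u_def Zero_fract_def eq_fract)

lemma laurent_to_ratfun_eq:
  "laurent_to_ratfun a = (\<Sum>k\<in>Poly_Mapping.keys a. const_ratfun (Poly_Mapping.lookup a k) * ratfun_u powi k)"
  by (simp add: laurent_to_ratfun_def const_ratfun_def)

lemma laurent_to_ratfun_0 [simp]: "laurent_to_ratfun 0 = 0"
  by (simp add: laurent_to_ratfun_def)

lemma laurent_to_ratfun_add [simp]:
  "laurent_to_ratfun (a + b) = laurent_to_ratfun a + laurent_to_ratfun b"
  unfolding laurent_to_ratfun_eq
  by (rule setsum_keys_plus_distrib) (simp_all add: distrib_right)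

lemma laurent_to_ratfun_single:
  "laurent_to_ratfun (Poly_Mapping.single k c) = const_ratfun c * ratfun_u powi k"
  by (simp add: laurent_to_ratfun_eq)

lemma laurent_to_ratfun_mult [simp]:
  "laurent_to_ratfun (a * b) = laurent_to_ratfun a * laurent_to_ratfun b"
proof -
  have 1: "laurent_to_ratfun (Poly_Mapping.single k c * b)
      = laurent_to_ratfun (Poly_Mapping.single k c) * laurent_to_ratfun b" for k c
  proof -
    have "Poly_Mapping.keys b \<subseteq> UNIV" by simp
    thus ?thesis
      by (induction rule: poly_mapping_keys_induct)
         (simp_all add: distrib_left mult_single laurent_to_ratfun_single
           power_int_add ratfun_u_nonzero)
  qed
  have "Poly_Mapping.keys a \<subseteq> UNIV" by simp
  thus ?thesis
    by (induction rule: poly_mapping_keys_induct) (simp_all add: distrib_right 1)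
qed

lemma laurent_to_ratfun_1 [simp]: "laurent_to_ratfun 1 = 1"
  using laurent_to_ratfun_single[of 0 1] by simp

lemma laurent_to_ratfun_u [simp]: "laurent_to_ratfun laurent_u = ratfun_u"
  using laurent_to_ratfun_single[of 1 1] by (simp add: laurent_u_def)

lemma laurent_to_ratfun_uminus [simp]: "laurent_to_ratfun (- a) = - laurent_to_ratfun a"
  using laurent_to_ratfun_add[of a "- a"] by (simp add: eq_neg_iff_add_eq_0 add.commute)

lemma laurent_to_ratfun_diff [simp]:
  "laurent_to_ratfun (a - b) = laurent_to_ratfun a - laurent_to_ratfun b"
  using laurent_to_ratfun_add[of a "- b"] by simp

section \<open>Adding an edge to an equivalence relation\<close>

text \<open>
  In the product \<open>e\<^sub>A * tie a b\<close> the relation \<open>A\<close> is replaced by \<open>join A a b\<close>.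
\<close>

definition join :: "('b \<times> 'b) set \<Rightarrow> 'b \<Rightarrow> 'b \<Rightarrow> ('b \<times> 'b) set" where
  "join A a b = eqcl (insert (a, b) A)"

lemma eqcl_mono: "A \<subseteq> B \<Longrightarrow> eqcl A \<subseteq> eqcl B"
  by (rule iffD2[OF eqcl_subset_iff]) (rule subset_trans[OF _ eqcl_superset])

lemma eqcl_insert_eqcl: "eqcl (insert x (eqcl A)) = eqcl (insert x A)"
proof (rule eqcl_eqI)
  have x: "x \<in> eqcl (insert x B)" for B by (rule subsetD[OF eqcl_superset insertI1])
  show "insert x (eqcl A) \<subseteq> eqcl (insert x A)"
    by (rule insert_subsetI[OF x]) (rule eqcl_mono[OF subset_insertI])
  show "insert x A \<subseteq> eqcl (insert x (eqcl A))"
    by (rule insert_subsetI[OF x])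
       (rule subset_trans[OF eqcl_superset subset_trans[OF subset_insertI eqcl_superset]])
qed

lemma join_join: "join (join A a b) c d = eqcl (insert (c, d) (insert (a, b) A))"
  by (simp add: join_def eqcl_insert_eqcl)

lemma eqcl_insert_absorb: "x \<in> eqcl A \<Longrightarrow> eqcl (insert x A) = eqcl A"
  by (intro eqcl_eqI insert_subsetI eqcl_superset)
     (simp_all add: subset_trans[OF subset_insertI eqcl_superset])

lemma join_sym: "join A a b = join A b a"
proof -
  have "insert (a, b) A \<subseteq> eqcl (insert (b, a) A)" for a b
    by (intro insert_subsetI eqcl_sym[OF subsetD[OF eqcl_superset insertI1]]
        subset_trans[OF subset_insertI eqcl_superset])
  thus ?thesis unfolding join_def by (intro eqcl_eqI)
qed

lemma join_left_commute: "join (join A a b) c d = join (join A c d) a b"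
  unfolding join_join by (simp add: insert_commute)

lemma join_absorb: "(c, d) \<in> eqcl (insert (a, b) A) \<Longrightarrow> join (join A a b) c d = join A a b"
  unfolding join_join unfolding join_def by (rule eqcl_insert_absorb)

lemma eqcl_insert_self: "(a, b) \<in> eqcl (insert (a, b) A)"
  by (rule subsetD[OF eqcl_superset insertI1])

lemma join_idem: "join (join A a b) a b = join A a b"
  by (rule join_absorb) (rule eqcl_insert_self)

text \<open>
  Any two edges of a triangle generate the same relation; this mirrors \<open>tie_triangle\<close>.
\<close>

lemma join_triangle: "join (join A a b) b c = join (join A a b) a c"
proof -
  let ?S = "insert (b, c) (insert (a, b) A)" and ?S' = "insert (a, c) (insert (a, b) A)"
  have "(a, b) \<in> eqcl ?S" "(b, c) \<in> eqcl ?S" using eqcl_superset[of ?S] by auto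
  hence 1: "(a, c) \<in> eqcl ?S" by (rule eqcl_trans)
  have "(a, b) \<in> eqcl ?S'" "(a, c) \<in> eqcl ?S'" using eqcl_superset[of ?S'] by auto
  hence 2: "(b, c) \<in> eqcl ?S'" by (metis eqcl_sym eqcl_trans)
  show ?thesis
    unfolding join_join using eqcl_insert_absorb[OF 1] eqcl_insert_absorb[OF 2]
    by (simp add: insert_commute)
qed

section \<open>A representation on functions\<close>

text \<open>
  Functions on the indices \<open>(A, w)\<close> of the expected basis; permutations are functions on points.
\<close>

type_synonym bt_fun = "(nat \<times> nat) set \<Rightarrow> (nat \<Rightarrow> nat) \<Rightarrow> ratfun"

text \<open>
  With \<open>J = join A (w i) (w (i + 1))\<close> and \<open>s\<close> the transposition of \<open>i\<close> and \<open>i + 1\<close>, the products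
  expected for a basis \<open>e\<^sub>A T\<^sub>w\<close> are \<open>e\<^sub>A T\<^sub>w E\<^sub>i = e\<^sub>J T\<^sub>w\<close>; \<open>e\<^sub>A T\<^sub>w T\<^sub>i = e\<^sub>A T\<^sub>w\<^sub>s\<close> if
  \<open>w i < w (i + 1)\<close>; and \<open>e\<^sub>A T\<^sub>w T\<^sub>i = e\<^sub>A T\<^sub>w\<^sub>s + (u - 1) (e\<^sub>J T\<^sub>w\<^sub>s + e\<^sub>J T\<^sub>w)\<close> otherwise. Right
  multiplication on the basis becomes a left action on functions of \<open>(A, w)\<close>, where a
  function is extended linearly and evaluated at the product.
\<close>

definition op_E :: "nat \<Rightarrow> bt_fun \<Rightarrow> bt_fun" where
  "op_E i f A w = f (join A (w i) (w (Suc i))) w"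

definition op_T :: "nat \<Rightarrow> bt_fun \<Rightarrow> bt_fun" where
  "op_T i f A w = f A (w \<circ> adj i) +
     (if w (Suc i) < w i
      then (ratfun_u - 1) * (f (join A (w i) (w (Suc i))) (w \<circ> adj i) + f (join A (w i) (w (Suc i))) w)
      else 0)"

fun gen_op :: "bt_gen \<Rightarrow> bt_fun \<Rightarrow> bt_fun" where
  "gen_op (T_gen i) = op_T i"
| "gen_op (E_gen i) = op_E i"

definition word_op :: "bt_gen list \<Rightarrow> bt_fun \<Rightarrow> bt_fun" where
  "word_op = foldr gen_op"

lemma word_op_append: "word_op (l @ l') f = word_op l (word_op l' f)"
  by (simp add: word_op_def)

lemma gen_op_linear:
  "gen_op x (\<lambda>A w. c * f A w + d * g A w) = (\<lambda>A w. c * gen_op x f A w + d * gen_op x g A w)"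
  by (cases x) (auto simp: op_T_def op_E_def fun_eq_iff algebra_simps)

lemma word_op_linear:
  "word_op l (\<lambda>A w. c * f A w + d * g A w) = (\<lambda>A w. c * word_op l f A w + d * word_op l g A w)"
  by (induction l) (simp_all add: word_op_def gen_op_linear)

text \<open>
  The relations hold only at injective \<open>w\<close>. For the elements acting as zero there to be closed under
  multiplication from the left, operators must not look at other arguments.
\<close>

lemma word_op_local:
  assumes "\<And>A w. inj w \<Longrightarrow> f A w = g A w" "inj w"
  shows "word_op l f A w = word_op l g A w"
  using assms(2)
proof (induction l arbitrary: A w)
  case Nil
  then show ?case by (simp add: word_op_def assms(1))
next
  case (Cons x l)
  have "inj (w \<circ> adj i)" for i using Cons.prems by (intro inj_compose) simp_all
  from Cons.IH[OF this] Cons.IH[OF Cons.prems] show ?case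
    by (cases x) (simp_all add: word_op_def op_T_def op_E_def o_def)
qed

definition act :: "bt_free \<Rightarrow> bt_fun \<Rightarrow> bt_fun" where
  "act p f A w = (\<Sum>k\<in>Poly_Mapping.keys p.
     laurent_to_ratfun (Poly_Mapping.lookup p k) * word_op (letters k) f A w)"

lemma act_0 [simp]: "act 0 f A w = 0"
  by (simp add: act_def)

lemma act_add [simp]: "act (p + q) f A w = act p f A w + act q f A w"
  unfolding act_def by (rule setsum_keys_plus_distrib) (simp_all add: distrib_right)

lemma act_uminus [simp]: "act (- p) f A w = - act p f A w"
  using act_add[of p "- p" f A w] by (simp add: eq_neg_iff_add_eq_0 add.commute)

lemma act_diff [simp]: "act (p - q) f A w = act p f A w - act q f A w"
  using act_add[of p "- q"] by simp

lemma act_single: "act (Poly_Mapping.single k a) f A w = laurent_to_ratfun a * word_op (letters k) f A w"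
  by (simp add: act_def)

lemma act_mult: "act (p * q) f A w = act p (act q f) A w"
proof -
  have 1: "act (Poly_Mapping.single k a * q) f A w
      = laurent_to_ratfun a * word_op (letters k) (act q f) A w" for k a
  proof -
    have "Poly_Mapping.keys q \<subseteq> UNIV" by simp
    thus ?thesis
    proof (induction arbitrary: A w rule: poly_mapping_keys_induct)
      case zero
      have "act 0 f = (\<lambda>A w. 0 * f A w + 0 * f A w)" by (simp add: fun_eq_iff)
      thus ?case by (simp add: word_op_linear[where c=0 and d=0, simplified])
    next
      case (single j b q)
      have "act (Poly_Mapping.single j b + q) f
          = (\<lambda>A w. laurent_to_ratfun b * word_op (letters j) f A w + 1 * act q f A w)"
        by (simp add: fun_eq_iff act_single)
      then show ?case using single
        by (simp add: distrib_left mult_single act_single plus_word_def word_op_append word_op_linear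
            word_op_linear[where d=1, simplified])
    qed
  qed
  have "Poly_Mapping.keys p \<subseteq> UNIV" by simp
  thus ?thesis
    by (induction rule: poly_mapping_keys_induct) (simp_all add: distrib_right 1 act_single)
qed

lemma act_T [simp]: "act (bt_T i) f = op_T i f"
  by (simp add: fun_eq_iff bt_T_def act_single word_op_def)

lemma act_E [simp]: "act (bt_E i) f = op_E i f"
  by (simp add: fun_eq_iff bt_E_def act_single word_op_def)

lemma act_scalar [simp]: "act (Poly_Mapping.single 0 a) f A w = laurent_to_ratfun a * f A w"
  by (simp add: act_single zero_word_def word_op_def)

lemma act_1 [simp]: "act 1 f A w = f A w"
  using act_scalar[of 1] by simp

lemma act_scale [simp]: "act (scale a p) f A w = laurent_to_ratfun a * act p f A w"
  by (simp add: scale_eq_mult act_mult)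

lemma act_local:
  assumes "\<And>A w. inj w \<Longrightarrow> f A w = g A w" "inj w"
  shows "act p f A w = act p g A w"
  unfolding act_def using word_op_local[OF assms] by simp

lemma adj_apply: "adj i i = Suc i" "adj i (Suc i) = i" "k \<noteq> i \<Longrightarrow> k \<noteq> Suc i \<Longrightarrow> adj i k = k"
  by (simp_all add: transpose_def)

lemma comp_adj_adj: "w \<circ> adj i \<circ> adj i = w"
  by (simp add: comp_assoc)

lemma adj_far: "far i j \<Longrightarrow> w \<circ> adj i \<circ> adj j = w \<circ> adj j \<circ> adj i"
  unfolding comp_assoc by (rule arg_cong[where f="(\<circ>) w"]) (auto simp: fun_eq_iff transpose_def far_def)

lemma adj_braid: "w \<circ> adj i \<circ> adj (Suc i) \<circ> adj i = w \<circ> adj (Suc i) \<circ> adj i \<circ> adj (Suc i)"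
  unfolding comp_assoc by (rule arg_cong[where f="(\<circ>) w"]) (auto simp: fun_eq_iff transpose_def)

lemma far_noteq: "far i j \<Longrightarrow> i \<noteq> j \<and> i \<noteq> Suc j \<and> Suc i \<noteq> j"
  by (auto simp: far_def)

lemma op_T_op_T_far:
  assumes "far i j"
  shows "op_T i (op_T j f) A w = op_T j (op_T i f) A w"
  using far_noteq[OF assms] adj_far[OF assms, of w]
  by (auto simp: op_T_def adj_apply join_left_commute[of A "w i"] algebra_simps)

lemma op_E_op_T_far:
  assumes "far i j"
  shows "op_E i (op_T j f) A w = op_T j (op_E i f) A w"
  using far_noteq[OF assms]
  by (auto simp: op_T_def op_E_def adj_apply join_left_commute[of A "w i"])

lemma op_E_op_E: "op_E i (op_E j f) A w = op_E j (op_E i f) A w"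
  by (simp add: op_E_def join_left_commute[of A "w i"])

lemma op_E_idem: "op_E i (op_E i f) A w = op_E i f A w"
  by (simp add: op_E_def join_idem)

lemma op_E_op_T_same: "op_E i (op_T i f) A w = op_T i (op_E i f) A w"
  by (simp add: op_T_def op_E_def adj_apply join_idem join_sym[of _ "w (Suc i)" "w i"])

lemma op_T_quadratic:
  assumes "inj w"
  shows "op_T i (op_T i f) A w = f A w + (ratfun_u - 1) * (op_E i f A w + op_E i (op_T i f) A w)"
proof -
  have "w i \<noteq> w (Suc i)" using injD[OF assms, of i "Suc i"] by auto
  thus ?thesis
    by (auto simp: op_T_def op_E_def adj_apply comp_adj_adj join_idem join_sym[of _ "w (Suc i)" "w i"]
        algebra_simps)
qed

lemma join3_rules:
  fixes A a b c
  defines "J \<equiv> join (join A a b) b c"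
  shows "join (join A a b) a c = J \<and> join (join A b c) a b = J \<and> join (join A b c) a c = J \<and>
    join (join A a c) a b = J \<and> join (join A a c) b c = J \<and> 
    join J a b = J \<and> join J b c = J \<and> join J a c = J"
proof (intro conjI)
  have 1: "join (join A a b) a c = J" unfolding J_def by (rule join_triangle[symmetric])
  have 2: "join (join A b c) a b = J" unfolding J_def by (rule join_left_commute)
  have 3: "join (join A b c) a c = J"
    using join_triangle[of A c b a] 2 by (metis join_sym)
  show "join (join A a b) a c = J" "join (join A b c) a b = J" "join (join A b c) a c = J"
    by (fact 1 2 3)+
  show "join (join A a c) a b = J" using 1 by (metis join_left_commute)
  show "join (join A a c) b c = J" using 3 by (metis join_left_commute)
  show "join J a b = J" unfolding J_def by (metis join_left_commute join_idem)
  show "join J b c = J" unfolding J_def by (rule join_idem)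
  show "join J a c = J" unfolding 1[symmetric] by (rule join_idem)
qed

text \<open>
  Both sides depend only on the order of the three values \<open>w i\<close>, \<open>w (i + 1)\<close>, \<open>w (i + 2)\<close>. In each of
  the six cases they expand to the same combination, as different pairs of ties among three points
  give the same relation.
\<close>

lemma op_T_braid:
  assumes "inj w"
  shows "op_T i (op_T (Suc i) (op_T i f)) A w = op_T (Suc i) (op_T i (op_T (Suc i) f)) A w"
proof -
  define a b c where "a = w i" and "b = w (Suc i)" and "c = w (Suc (Suc i))"
  have abc: "a \<noteq> b" "b \<noteq> c" "a \<noteq> c"
    unfolding a_def b_def c_def using assms by (simp_all add: inj_eq)
  note J = join3_rules[of A a b c]
  note val = a_def[symmetric] b_def[symmetric] c_def[symmetric]
  consider "a < b" "b < c" "a < c" | "a < b" "c < b" "a < c" | "a < b" "c < b" "c < a"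
    | "b < a" "b < c" "a < c" | "b < a" "b < c" "c < a" | "b < a" "c < b" "c < a"
    using abc by linarith
  thus ?thesis
    by cases (simp_all add: op_T_def adj_apply comp_adj_adj val J join_idem
        join_sym[of _ b a] join_sym[of _ c b] join_sym[of _ c a] adj_braid
        not_less_iff_gr_or_eq algebra_simps)
qed

lemma op_tie_relations:
  shows "op_E (Suc i) (op_T i (op_T (Suc i) f)) A w = op_T i (op_T (Suc i) (op_E i f)) A w"
    and "op_E i (op_T (Suc i) (op_T i f)) A w = op_T (Suc i) (op_T i (op_E (Suc i) f)) A w"
    and "op_E i (op_E (Suc i) (op_T (Suc i) f)) A w = op_E i (op_T (Suc i) (op_E i f)) A w"
    and "op_E (Suc i) (op_E i (op_T i f)) A w = op_E (Suc i) (op_T i (op_E (Suc i) f)) A w"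
    and "op_E i (op_T (Suc i) (op_E i f)) A w = op_T (Suc i) (op_E i (op_E (Suc i) f)) A w"
    and "op_E (Suc i) (op_T i (op_E (Suc i) f)) A w = op_T i (op_E (Suc i) (op_E i f)) A w"
proof -
  define a b c where "a = w i" and "b = w (Suc i)" and "c = w (Suc (Suc i))"
  note simps = op_T_def op_E_def adj_apply a_def[symmetric] b_def[symmetric] c_def[symmetric]
    join3_rules[of A a b c] join_idem join_sym[of _ b a] join_sym[of _ c b] join_sym[of _ c a]
  show "op_E (Suc i) (op_T i (op_T (Suc i) f)) A w = op_T i (op_T (Suc i) (op_E i f)) A w"
    by (cases "b < a"; cases "c < b"; cases "c < a"; simp add: simps)
  show "op_E i (op_T (Suc i) (op_T i f)) A w = op_T (Suc i) (op_T i (op_E (Suc i) f)) A w"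
    by (cases "b < a"; cases "c < b"; cases "c < a"; simp add: simps)
  show "op_E i (op_E (Suc i) (op_T (Suc i) f)) A w = op_E i (op_T (Suc i) (op_E i f)) A w"
    by (cases "c < b"; simp add: simps)
  show "op_E (Suc i) (op_E i (op_T i f)) A w = op_E (Suc i) (op_T i (op_E (Suc i) f)) A w"
    by (cases "b < a"; simp add: simps)
  show "op_E i (op_T (Suc i) (op_E i f)) A w = op_T (Suc i) (op_E i (op_E (Suc i) f)) A w"
    by (cases "c < b"; simp add: simps)
  show "op_E (Suc i) (op_T i (op_E (Suc i) f)) A w = op_T i (op_E (Suc i) (op_E i f)) A w"
    by (cases "b < a"; simp add: simps)
qed

lemma adjacent_cases: "adjacent i j \<Longrightarrow> j = Suc i \<or> i = Suc j"
  by (auto simp: adjacent_def)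

theorem act_respects_relations:
  assumes "bt_rel n p q" "inj w"
  shows "act p f A w = act q f A w"
  using assms(1)
proof cases
  case (T_T_far i j)
  then show ?thesis using op_T_op_T_far by (simp add: act_mult)
next
  case (E_E i j)
  then show ?thesis using op_E_op_E[of i j] by (simp add: act_mult)
next
  case (E_T_far i j)
  then show ?thesis using op_E_op_T_far by (simp add: act_mult)
next
  case (E_idem i)
  then show ?thesis by (simp add: act_mult power2_eq_square op_E_idem)
next
  case (E_T_same i)
  then show ?thesis by (simp add: act_mult op_E_op_T_same)
next
  case (braid i j)
  then show ?thesis using adjacent_cases[of i j] op_T_braid[OF assms(2)] by (auto simp: act_mult)
next
  case (E_T_T i j)
  then show ?thesis using adjacent_cases[of i j] op_tie_relations(1,2) by (auto simp: act_mult)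
next
  case (E_E_T i j)
  then show ?thesis using adjacent_cases[of i j] op_tie_relations(3,4) by (auto simp: act_mult)
next
  case (E_T_E i j)
  then show ?thesis using adjacent_cases[of i j] op_tie_relations(5,6) by (auto simp: act_mult)
next
  case (quadratic i)
  have "act (bt_E i * (1 + bt_T i)) f A w = op_E i f A w + op_E i (op_T i f) A w"
    by (simp add: act_mult op_E_def)
  then show ?thesis
    by (simp add: quadratic act_mult power2_eq_square op_T_quadratic[OF assms(2)])
qed

text \<open>
  The elements that act as zero at injective \<open>w\<close> form an ideal that contains the differences of the
  defining relations.
\<close>

theorem act_ideal:
  assumes "p \<in> bt_ideal n" "inj w"
  shows "act p f A w = 0"
proof -
  let ?J = "{p \<in> bt_elems n. \<forall>f A w. inj w \<longrightarrow> act p f A w = 0}"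
  have "ideal ?J (bt_free_algebra n)"
  proof (rule idealI[OF ring_bt_free_algebra])
    show "subgroup ?J (add_monoid (bt_free_algebra n))"
    proof (rule group.subgroupI)
      show "group (add_monoid (bt_free_algebra n))"
        using ring.is_abelian_group[OF ring_bt_free_algebra] by (rule abelian_group.a_group)
      show "?J \<noteq> {}" by (auto intro!: exI[of _ 0])
      fix a assume a: "a \<in> ?J"
      have "inv\<^bsub>add_monoid (bt_free_algebra n)\<^esub> a = - a"
        by (rule group.inv_equality[OF \<open>group (add_monoid (bt_free_algebra n))\<close>]) (use a in auto)
      thus "inv\<^bsub>add_monoid (bt_free_algebra n)\<^esub> a \<in> ?J" using a by simp
    qed auto
    fix a x assume a: "a \<in> ?J" and x: "x \<in> carrier (bt_free_algebra n)"
    have "act x (act a f) A w = act x (\<lambda>A w. 0) A w" if "inj w" for f A w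
      using a that by (intro act_local) auto
    moreover have "act x (\<lambda>A w. 0) A w = 0" for A w
      using word_op_linear[where c=0 and d=0] by (simp add: act_def)
    ultimately show "x \<otimes>\<^bsub>bt_free_algebra n\<^esub> a \<in> ?J" using a x by (simp add: act_mult)
    show "a \<otimes>\<^bsub>bt_free_algebra n\<^esub> x \<in> ?J" using a x by (simp add: act_mult)
  qed
  hence "bt_ideal n \<subseteq> ?J"
    by (rule bt_ideal_least) (auto dest: bt_rel_elems simp: act_respects_relations)
  thus ?thesis using assms by blast
qed

text \<open>
  Evaluation at \<open>(eqcl {}, id)\<close>, the index of the unit element. If \<open>p\<close> acts as \<open>e\<^sub>A T\<^sub>w\<close>, this is the
  value of \<open>f\<close> at \<open>(A, w)\<close>.
\<close>

definition pairing :: "bt_free \<Rightarrow> bt_fun \<Rightarrow> ratfun" where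
  "pairing p f = act p f (eqcl {}) id"

definition reached :: "nat \<Rightarrow> (nat \<times> nat) set \<Rightarrow> (nat \<Rightarrow> nat) \<Rightarrow> bool" where
  "reached n A w \<longleftrightarrow> (\<exists>p\<in>bt_elems n. \<forall>f. pairing p f = f A w)"

lemma reached_step:
  assumes "reached n A w" "q \<in> bt_elems n" "\<And>f. act q f A w = f B v"
  shows "reached n B v"
proof -
  obtain p where p: "p \<in> bt_elems n" "\<And>f. pairing p f = f A w"
    using assms(1) by (auto simp: reached_def)
  have "pairing (p * q) f = f B v" for f
    using p(2)[of "act q f"] assms(3) by (simp add: pairing_def act_mult)
  thus ?thesis using p(1) assms(2) by (auto simp: reached_def intro!: bexI[of _ "p * q"])
qed

lemma reached_E:
  assumes "reached n A w" "i \<in> {1..<n}"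
  shows "reached n (join A (w i) (w (Suc i))) w"
  using assms(1)
  by (rule reached_step[where q="bt_E i"]) (use assms(2) in \<open>simp_all add: op_E_def del: atLeastLessThan_iff\<close>)

lemma laurent_to_ratfun_u_inv: "laurent_to_ratfun laurent_u_inv * ratfun_u = 1"
  using laurent_to_ratfun_mult[of laurent_u laurent_u_inv] laurent_u_inverse by (simp add: mult.commute)

text \<open>
  If \<open>i\<close> is a descent of \<open>w\<close>, multiplication by the inverse of \<open>T\<^sub>i\<close> instead of \<open>T\<^sub>i\<close> leads to a single
  index.
\<close>

lemma reached_T:
  assumes "reached n A w" "i \<in> {1..<n}"
  shows "reached n A (w \<circ> adj i)"
proof (cases "w (Suc i) < w i")
  case False
  show ?thesis
    using assms(1)
    by (rule reached_step[where q="bt_T i"])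
       (use assms(2) False in \<open>simp_all add: op_T_def del: atLeastLessThan_iff\<close>)
next
  case True
  let ?v = "laurent_to_ratfun laurent_u_inv"
  let ?J = "join A (w i) (w (Suc i))"
  \<comment> \<open>the inverse of \<open>T\<^sub>i\<close>\<close>
  let ?q = "bt_T i + scale (laurent_u_inv - 1) (bt_E i) + scale (laurent_u_inv - 1) (bt_E i * bt_T i)"
  show ?thesis
    using assms(1)
  proof (rule reached_step[where q="?q"])
    show "?q \<in> bt_elems n" using assms(2) by (simp del: atLeastLessThan_iff)
    fix f
    have 1: "op_T i f A w = f A (w \<circ> adj i) + (ratfun_u - 1) * (f ?J (w \<circ> adj i) + f ?J w)"
      and 2: "op_E i (op_T i f) A w = f ?J (w \<circ> adj i) + (ratfun_u - 1) * (f ?J (w \<circ> adj i) + f ?J w)"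
      using True by (simp_all add: op_T_def op_E_def join_idem)
    have "act ?q f A w = f A (w \<circ> adj i) + (?v * ratfun_u - 1) * (f ?J (w \<circ> adj i) + f ?J w)"
      by (simp add: act_mult 1 2) (simp add: op_E_def algebra_simps)
    thus "act ?q f A w = f A (w \<circ> adj i)"
      by (simp add: laurent_to_ratfun_u_inv)
  qed
qed

lemma reached_permutation:
  assumes "reached n A w" "w permutes {1..n}" "v permutes {1..n}"
  shows "reached n A v"
proof -
  have *: "reached n A (w \<circ> p)" if "p permutes {1..n}" for p
    using that
  proof (induction rule: permutes_adjacent_induct)
    case id
    show ?case using assms(1) by simp
  next
    case (adj k p)
    have "reached n A (w \<circ> p \<circ> adj k)"
      by (rule reached_T[OF adj(3)]) (use adj in simp)
    then show ?case by (simp only: comp_assoc)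
  qed
  have "w \<circ> (Hilbert_Choice.inv w \<circ> v) = v"
    using assms(2) by (simp add: comp_assoc[symmetric] permutes_inv_o)
  thus ?thesis using *[of "Hilbert_Choice.inv w \<circ> v"] assms(2,3) by (metis permutes_compose permutes_inv)
qed

text \<open>
  To add the edge \<open>(a, b)\<close> to the relation, one goes to a permutation that takes \<open>1, 2\<close> to \<open>a, b\<close>,
  multiplies by \<open>E\<^sub>1\<close>, and returns to the permutation wanted.
\<close>

theorem reached_all:
  assumes "finite R" "R \<subseteq> {1..n} \<times> {1..n}" "w permutes {1..n}"
  shows "reached n (eqcl R) w"
  using assms(1,2,3)
proof (induction R arbitrary: w rule: finite_induct)
  case empty
  have "reached n (eqcl {}) id"
    unfolding reached_def pairing_def by (rule bexI[of _ 1]) simp_all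
  thus ?case using reached_permutation permutes_id empty by blast
next
  case (insert x R)
  obtain a b where x: "x = (a, b)" by (cases x)
  have ab: "a \<in> {1..n}" "b \<in> {1..n}" using insert.prems x by auto
  have R: "reached n (eqcl R) w" if "w permutes {1..n}" for w
    using insert that by auto
  have j: "eqcl (insert x R) = join (eqcl R) a b"
    by (simp add: join_def x eqcl_insert_eqcl)
  show ?case
  proof (cases "a = b")
    case True
    hence "eqcl (insert x R) = eqcl R" using x by (simp add: eqcl_insert_absorb eqcl_refl)
    thus ?thesis using R insert.prems by simp
  next
    case False
    hence "distinct [a, b]" "set [a, b] \<subseteq> {1..n}" using ab by auto
    then obtain v where v: "v permutes {1..n}" "\<forall>i<length [a, b]. v (Suc i) = [a, b] ! i"
      using distinct_extends_to_permutation by blast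
    have "v 1 = a" "v (Suc 1) = b" using v(2) by auto
    moreover have "1 \<in> {1..<n}" using False ab by auto
    ultimately have "reached n (join (eqcl R) a b) v"
      using reached_E[OF R[OF v(1)], of 1] by simp
    thus ?thesis using reached_permutation v(1) insert.prems j by metis
  qed
qed

section \<open>Extension of scalars\<close>

definition ideal_class :: "nat \<Rightarrow> bt_free \<Rightarrow> bt_free set" where
  "ideal_class n p = bt_ideal n +>\<^bsub>bt_free_algebra n\<^esub> p"

lemma bt_abelian_subgroup: "abelian_subgroup (bt_ideal n) (bt_free_algebra n)"
  by (intro abelian_subgroupI3 ideal.axioms(1)[OF bt_ideal_is_ideal]
      ring.is_abelian_group[OF ring_bt_free_algebra])

lemma ideal_class_eq: "p \<in> bt_elems n \<Longrightarrow> ideal_class n p = {q. cong_bt n q p}"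
proof -
  assume p: "p \<in> bt_elems n"
  have "x \<in> ideal_class n p \<longleftrightarrow> (\<exists>h\<in>bt_ideal n. x = h + p)" for x
    by (auto simp: ideal_class_def a_r_coset_def')
  also have "\<dots> x \<longleftrightarrow> cong_bt n x p" for x
    using p bt_ideal_elems[of "x - p" n] bt_elems_add[of "x - p" n p]
    by (auto simp: cong_bt_def bt_ideal_elems intro!: bexI[of _ "x - p"])
  finally show ?thesis by blast
qed

lemma ideal_class_cong:
  assumes "cong_bt n p q"
  shows "ideal_class n p = ideal_class n q"
proof -
  have "cong_bt n x p \<longleftrightarrow> cong_bt n x q" for x
    by (meson assms cong_bt_sym cong_bt_trans)
  thus ?thesis using assms by (simp add: ideal_class_eq cong_bt_def[of n p q])
qed

lemma carrier_bt_laurent: "carrier (bt_algebra_laurent n) = ideal_class n ` bt_elems n"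
  by (auto simp: bt_algebra_laurent_def quotient_algebra_def FactRing_def A_RCOSETS_def' ideal_class_def)

lemma add_bt_laurent:
  "p \<in> bt_elems n \<Longrightarrow> q \<in> bt_elems n \<Longrightarrow>
    ideal_class n p \<oplus>\<^bsub>bt_algebra_laurent n\<^esub> ideal_class n q = ideal_class n (p + q)"
  using abelian_subgroup.a_rcos_sum[OF bt_abelian_subgroup, of p n q]
  by (simp add: bt_algebra_laurent_def quotient_algebra_def FactRing_def ideal_class_def)

lemma smult_bt_laurent:
  assumes "p \<in> bt_elems n"
  shows "a \<odot>\<^bsub>bt_algebra_laurent n\<^esub> ideal_class n p = ideal_class n (scale a p)"
proof -
  have "ideal_class n (scale a q) = ideal_class n (scale a p)" if "q \<in> ideal_class n p" for q
    using that assms unfolding scale_eq_mult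
    by (intro ideal_class_cong cong_bt_mult cong_bt_refl) (simp_all add: ideal_class_eq)
  moreover have "p \<in> ideal_class n p" using assms by (simp add: ideal_class_eq cong_bt_refl)
  ultimately have "(\<Union>q\<in>ideal_class n p. ideal_class n (scale a q)) = ideal_class n (scale a p)" by blast
  thus ?thesis
    by (simp add: bt_algebra_laurent_def quotient_algebra_def ideal_class_def)
qed

definition tens_group :: "nat \<Rightarrow> (bt_free set \<times> ratfun \<Rightarrow>\<^sub>0 int) monoid" where
  "tens_group n = free_Abelian_group (ideal_class n ` bt_elems n \<times> UNIV)"

text \<open>
  The subgroup of those formal sums that represent zero in the tensor product.
\<close>

definition tens_zero :: "nat \<Rightarrow> (bt_free set \<times> ratfun \<Rightarrow>\<^sub>0 int) set" where
  "tens_zero n = tensor_subgroup (bt_algebra_laurent n) ratfun_module UNIV"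

abbreviation tens_elem :: "nat \<Rightarrow> (bt_free set \<times> ratfun \<Rightarrow>\<^sub>0 int) \<Rightarrow> bool" where
  "tens_elem n c \<equiv> Poly_Mapping.keys c \<subseteq> ideal_class n ` bt_elems n \<times> UNIV"

definition pure :: "nat \<Rightarrow> bt_free \<Rightarrow> ratfun \<Rightarrow> (bt_free set \<times> ratfun \<Rightarrow>\<^sub>0 int)" where
  "pure n p x = frag_of (ideal_class n p, x)"

lemma ratfun_module_simps [simp]:
  "carrier ratfun_module = UNIV" "ring.add ratfun_module = (+)"
  "monoid.mult ratfun_module = (*)" "monoid.one ratfun_module = 1"
  "a \<odot>\<^bsub>ratfun_module\<^esub> x = laurent_to_ratfun a * x"
  by (simp_all add: ratfun_module_def)

lemma comm_group_tens: "comm_group (tens_group n)"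
  by (simp add: tens_group_def abelian_free_Abelian_group)

lemma tens_group_simps [simp]:
  "c \<in> carrier (tens_group n) \<longleftrightarrow> tens_elem n c"
  "c \<otimes>\<^bsub>tens_group n\<^esub> d = c + d" "\<one>\<^bsub>tens_group n\<^esub> = 0"
  "tens_elem n c \<Longrightarrow> inv\<^bsub>tens_group n\<^esub> c = - c"
  by (simp_all add: tens_group_def)

lemma pure_elem: "p \<in> bt_elems n \<Longrightarrow> tens_elem n (pure n p x)"
  by (simp add: pure_def)

lemma tens_elem_add: "tens_elem n c \<Longrightarrow> tens_elem n d \<Longrightarrow> tens_elem n (c + d)"
  using keys_add[of c d] by blast

lemma tens_elem_diff: "tens_elem n c \<Longrightarrow> tens_elem n d \<Longrightarrow> tens_elem n (c - d)"
  using keys_diff[of c d] by blast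

lemma tensor_relations_cases:
  assumes "r \<in> tensor_relations (bt_algebra_laurent n) ratfun_module UNIV"
  obtains (add_left) p q x where "p \<in> bt_elems n" "q \<in> bt_elems n" "r = pure n (p + q) x - pure n p x - pure n q x"
  | (add_right) p x y where "p \<in> bt_elems n" "r = pure n p (x + y) - pure n p x - pure n p y"
  | (balanced) p a x where "p \<in> bt_elems n" "r = pure n (scale a p) x - pure n p (laurent_to_ratfun a * x)"
  using assms unfolding tensor_relations_def carrier_bt_laurent
  by (auto simp: add_bt_laurent smult_bt_laurent pure_def)

lemma tensor_relations_intros:
  assumes "p \<in> bt_elems n" "q \<in> bt_elems n"
  shows "pure n (p + q) x - pure n p x - pure n q x \<in> tensor_relations (bt_algebra_laurent n) ratfun_module UNIV"
    and "pure n p (x + y) - pure n p x - pure n p y \<in> tensor_relations (bt_algebra_laurent n) ratfun_module UNIV"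
    and "pure n (scale a p) x - pure n p (laurent_to_ratfun a * x)
      \<in> tensor_relations (bt_algebra_laurent n) ratfun_module UNIV"
proof -
  let ?R = "tensor_relations (bt_algebra_laurent n) ratfun_module UNIV"
  have c: "ideal_class n p \<in> carrier (bt_algebra_laurent n)" "ideal_class n q \<in> carrier (bt_algebra_laurent n)"
    using assms by (auto simp: carrier_bt_laurent)
  have "frag_of (ideal_class n p \<oplus>\<^bsub>bt_algebra_laurent n\<^esub> ideal_class n q, x) - frag_of (ideal_class n p, x) - frag_of (ideal_class n q, x) \<in> ?R"
    unfolding tensor_relations_def using c by (intro UnI1) (simp, blast)
  thus "pure n (p + q) x - pure n p x - pure n q x \<in> ?R"
    using assms by (simp add: add_bt_laurent pure_def)
  have "frag_of (ideal_class n p, x \<oplus>\<^bsub>ratfun_module\<^esub> y) - frag_of (ideal_class n p, x) - frag_of (ideal_class n p, y) \<in> ?R"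
    unfolding tensor_relations_def using c by (intro UnI1 UnI2) (simp, blast)
  thus "pure n p (x + y) - pure n p x - pure n p y \<in> ?R"
    by (simp add: pure_def)
  have "frag_of (a \<odot>\<^bsub>bt_algebra_laurent n\<^esub> ideal_class n p, x) - frag_of (ideal_class n p, a \<odot>\<^bsub>ratfun_module\<^esub> x) \<in> ?R"
    unfolding tensor_relations_def
    by (rule UnI2, rule CollectI, intro exI conjI, rule refl) (simp_all add: c)
  thus "pure n (scale a p) x - pure n p (laurent_to_ratfun a * x) \<in> ?R"
    using assms by (simp add: smult_bt_laurent pure_def)
qed

lemma tens_zero_eq:
  "tens_zero n = generate (tens_group n) (tensor_relations (bt_algebra_laurent n) ratfun_module UNIV)"
  by (simp add: tens_zero_def tensor_subgroup_def tens_group_def carrier_bt_laurent)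

lemma tensor_relations_elem:
  "r \<in> tensor_relations (bt_algebra_laurent n) ratfun_module UNIV \<Longrightarrow> tens_elem n r"
  by (erule tensor_relations_cases) (simp_all only: tens_elem_diff pure_elem bt_elems_add bt_elems_scale)

lemma subgroup_tens_zero: "subgroup (tens_zero n) (tens_group n)"
  unfolding tens_zero_eq
  by (rule group.generate_is_subgroup[OF comm_group.axioms(2)[OF comm_group_tens]])
     (auto dest: tensor_relations_elem)

lemma tens_zero_elem: "c \<in> tens_zero n \<Longrightarrow> tens_elem n c"
  using subgroup.subset[OF subgroup_tens_zero] tens_group_simps(1) by blast

lemma tens_zero_0: "0 \<in> tens_zero n"
  using subgroup.one_closed[OF subgroup_tens_zero] by simp

lemma tens_zero_add: "c \<in> tens_zero n \<Longrightarrow> d \<in> tens_zero n \<Longrightarrow> c + d \<in> tens_zero n"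
  using subgroup.m_closed[OF subgroup_tens_zero] by fastforce

lemma tens_zero_uminus: "c \<in> tens_zero n \<Longrightarrow> - c \<in> tens_zero n"
  using subgroup.m_inv_closed[OF subgroup_tens_zero, of c n] tens_zero_elem by simp

lemma tens_zero_diff: "c \<in> tens_zero n \<Longrightarrow> d \<in> tens_zero n \<Longrightarrow> c - d \<in> tens_zero n"
  using tens_zero_add[of c n "- d"] tens_zero_uminus[of d n] by simp

text \<open>
  Closure under differences is enough for a property to pass from the relations to the subgroup that
  they generate, the relations being nonempty.
\<close>

lemma tens_zero_induct [consumes 1, case_names rel diff]:
  assumes "c \<in> tens_zero n"
    and rel: "\<And>r. r \<in> tensor_relations (bt_algebra_laurent n) ratfun_module UNIV \<Longrightarrow> P r"
    and diff: "\<And>c d. P c \<Longrightarrow> P d \<Longrightarrow> P (c - d)" 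
  shows "P c"
proof -
  have r0: "P 0" 
    using diff[OF rel rel, OF tensor_relations_intros(1)[of 0 n 0 0] tensor_relations_intros(1)[of 0 n 0 0]] by simp
  have um: "P (- c)" if "P c" for c using diff[OF r0 that] by simp
  show ?thesis
    using assms(1) unfolding tens_zero_eq
  proof (induction rule: generate.induct)
    case one
    show ?case using r0 by simp
  next
    case (incl h)
    thus ?case by (rule rel)
  next
    case (inv h)
    thus ?case using um[OF rel] tensor_relations_elem by simp
  next
    case (eng h1 h2)
    thus ?case using diff[OF eng(3) um[OF eng(4)]] by simp
  qed
qed

definition tensor_coset :: "nat \<Rightarrow> (bt_free set \<times> ratfun \<Rightarrow>\<^sub>0 int) \<Rightarrow> (bt_free set \<times> ratfun \<Rightarrow>\<^sub>0 int) set" where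
  "tensor_coset n c = tens_zero n #>\<^bsub>tens_group n\<^esub> c"

lemma mem_tensor_coset_iff: "d \<in> tensor_coset n c \<longleftrightarrow> d - c \<in> tens_zero n"
proof -
  have "d \<in> tensor_coset n c \<longleftrightarrow> (\<exists>h\<in>tens_zero n. d = h + c)" by (auto simp: tensor_coset_def r_coset_def)
  also have "\<dots> \<longleftrightarrow> d - c \<in> tens_zero n" by (auto intro!: bexI[of _ "d - c"])
  finally show ?thesis .
qed

lemma tensor_coset_eq_iff: "tensor_coset n c = tensor_coset n d \<longleftrightarrow> c - d \<in> tens_zero n"
proof
  assume "tensor_coset n c = tensor_coset n d"
  moreover have "c \<in> tensor_coset n c" by (simp add: mem_tensor_coset_iff tens_zero_0)
  ultimately show "c - d \<in> tens_zero n" using mem_tensor_coset_iff by blast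
next
  assume *: "c - d \<in> tens_zero n"
  show "tensor_coset n c = tensor_coset n d"
  proof (intro Set.set_eqI iffI)
    fix x assume "x \<in> tensor_coset n c"
    thus "x \<in> tensor_coset n d" using tens_zero_add[OF _ *, of "x - c"] by (simp add: mem_tensor_coset_iff)
  next
    fix x assume "x \<in> tensor_coset n d"
    thus "x \<in> tensor_coset n c" using tens_zero_diff[OF _ *, of "x - d"] by (simp add: mem_tensor_coset_iff)
  qed
qed

text \<open>
  The action of the field on formal sums, before passing to the tensor product.
\<close>

definition rescale :: "ratfun \<Rightarrow> (bt_free set \<times> ratfun \<Rightarrow>\<^sub>0 int) \<Rightarrow> (bt_free set \<times> ratfun \<Rightarrow>\<^sub>0 int)" where
  "rescale y = frag_extend (\<lambda>(m, x). frag_of (m, y * x))"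

lemma rescale_pure [simp]: "rescale y (pure n p x) = pure n p (y * x)"
  by (simp add: rescale_def pure_def)

lemma rescale_diff: "rescale y (c - d) = rescale y c - rescale y d"
  by (simp add: rescale_def frag_extend_diff)

lemma rescale_add: "rescale y (c + d) = rescale y c + rescale y d"
  by (simp add: rescale_def frag_extend_add)

lemma tens_elem_induct [consumes 1, case_names zero diff pure]:
  assumes "tens_elem n c" "P 0"
    and "\<And>c d. tens_elem n c \<Longrightarrow> tens_elem n d \<Longrightarrow> P c \<Longrightarrow> P d \<Longrightarrow> P (c - d)"
    and "\<And>p x. p \<in> bt_elems n \<Longrightarrow> P (pure n p x)"
  shows "P c"
  using assms(1)
  by (rule free_Abelian_group_induct) (use assms(2-4) in \<open>auto simp: pure_def\<close>)

lemma rescale_elem: "tens_elem n c \<Longrightarrow> tens_elem n (rescale y c)"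
proof (induction rule: tens_elem_induct)
  case zero
  show ?case by (simp add: rescale_def)
next
  case (diff c d)
  thus ?case unfolding rescale_diff by (intro tens_elem_diff)
next
  case (pure p x)
  thus ?case by (simp add: pure_elem)
qed

lemma tens_zero_rel: "r \<in> tensor_relations (bt_algebra_laurent n) ratfun_module UNIV \<Longrightarrow> r \<in> tens_zero n"
  unfolding tens_zero_eq by (rule generate.incl)

lemma rescale_tens_zero: "c \<in> tens_zero n \<Longrightarrow> rescale y c \<in> tens_zero n"
proof (induction rule: tens_zero_induct)
  case (rel r)
  thus ?case
  proof (cases rule: tensor_relations_cases)
    case (add_left p q x)
    thus ?thesis by (simp add: rescale_diff tens_zero_rel tensor_relations_intros)
  next
    case (add_right p x z)
    thus ?thesis using tensor_relations_intros(2)[of p n p "y * x" "y * z"]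
      by (simp add: rescale_diff tens_zero_rel distrib_left)
  next
    case (balanced p a x)
    thus ?thesis using tensor_relations_intros(3)[of p n p a "y * x"]
      by (simp add: rescale_diff tens_zero_rel mult.left_commute)
  qed
next
  case (diff c d)
  thus ?case by (simp add: rescale_diff tens_zero_diff)
qed

lemma bt_algebra_carrier: "carrier (bt_algebra n) = tensor_coset n ` {c. tens_elem n c}"
  unfolding bt_algebra_def extend_scalars_def Let_def
  by (auto simp: RCOSETS_def tensor_coset_def tens_zero_def[symmetric] carrier_bt_laurent tens_group_def[symmetric])

lemma bt_algebra_zero: "\<zero>\<^bsub>bt_algebra n\<^esub> = tensor_coset n 0"
proof -
  have "\<zero>\<^bsub>bt_algebra n\<^esub> = tens_zero n"
    by (simp add: bt_algebra_def extend_scalars_def Let_def tens_zero_def)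
  also have "\<dots> = tensor_coset n 0" by (auto simp: mem_tensor_coset_iff)
  finally show ?thesis .
qed

lemma bt_algebra_add:
  assumes "tens_elem n c" "tens_elem n d"
  shows "tensor_coset n c \<oplus>\<^bsub>bt_algebra n\<^esub> tensor_coset n d = tensor_coset n (c + d)"
proof -
  have "tens_zero n \<lhd> tens_group n"
    by (rule comm_group.subgroup_imp_normal[OF comm_group_tens subgroup_tens_zero])
  from normal.rcos_sum[OF this, of c d] show ?thesis using assms
    by (simp add: bt_algebra_def extend_scalars_def Let_def tens_zero_def[symmetric] tensor_coset_def
        carrier_bt_laurent tens_group_def[symmetric])
qed

lemma bt_algebra_smult:
  "y \<odot>\<^bsub>bt_algebra n\<^esub> tensor_coset n c = tensor_coset n (rescale y c)"
proof -
  have "y \<odot>\<^bsub>bt_algebra n\<^esub> tensor_coset n c = (\<Union>d\<in>tensor_coset n c. tensor_coset n (rescale y d))"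
    by (simp add: bt_algebra_def extend_scalars_def Let_def tens_zero_def[symmetric] tensor_coset_def
        carrier_bt_laurent tens_group_def[symmetric] rescale_def)
  moreover have "tensor_coset n (rescale y d) = tensor_coset n (rescale y c)" if "d \<in> tensor_coset n c" for d
    using that rescale_tens_zero[of "d - c" n y] by (simp add: tensor_coset_eq_iff mem_tensor_coset_iff rescale_diff)
  moreover have "c \<in> tensor_coset n c" by (simp add: mem_tensor_coset_iff tens_zero_0)
  ultimately show ?thesis by blast
qed

text \<open>
  Distributivity over sums of scalars holds only modulo the relations of the tensor product, and is
  checked on pure tensors; the other laws hold already for formal sums.
\<close>

lemma vectorspace_bt_algebra: "vectorspace (class_ring :: ratfun ring) (bt_algebra n)"
proof -
  have r1: "rescale (x + y) c - (rescale x c + rescale y c) \<in> tens_zero n"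
    if "tens_elem n c" for x y c
    using that
  proof (induction rule: tens_elem_induct)
    case zero
    show ?case by (simp add: rescale_def tens_zero_0)
  next
    case (diff c d)
    have "rescale (x + y) (c - d) - (rescale x (c - d) + rescale y (c - d))
        = (rescale (x + y) c - (rescale x c + rescale y c)) - (rescale (x + y) d - (rescale x d + rescale y d))"
      by (simp add: rescale_diff)
    thus ?case using diff tens_zero_diff by metis
  next
    case (pure p z)
    thus ?case using tensor_relations_intros(2)[of p n p "x * z" "y * z"]
      by (simp add: distrib_right tens_zero_rel diff_diff_add)
  qed
  hence r1': "tensor_coset n (rescale (x + y) c) = tensor_coset n (rescale x c + rescale y c)"
    if "tens_elem n c" for x y c
    using that by (simp add: tensor_coset_eq_iff)
  have r2: "rescale (x * y) c = rescale x (rescale y c)" if "tens_elem n c" for x y c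
    using that by (induction rule: tens_elem_induct) (simp_all add: rescale_def frag_extend_diff pure_def mult.assoc)
  have r3: "rescale 1 c = c" if "tens_elem n c" for c
    using that by (induction rule: tens_elem_induct) (simp_all add: rescale_def frag_extend_diff pure_def)
  have ab: "abelian_group (bt_algebra n)"
  proof (rule abelian_groupI)
    fix x assume "x \<in> carrier (bt_algebra n)"
    then obtain c where c: "x = tensor_coset n c" "tens_elem n c" by (auto simp: bt_algebra_carrier)
    thus "\<exists>y\<in>carrier (bt_algebra n). y \<oplus>\<^bsub>bt_algebra n\<^esub> x = \<zero>\<^bsub>bt_algebra n\<^esub>"
      by (intro bexI[of _ "tensor_coset n (- c)"])
         (auto simp: bt_algebra_add bt_algebra_zero bt_algebra_carrier)
  qed (auto simp: bt_algebra_carrier bt_algebra_add bt_algebra_zero tens_elem_add ac_simps)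
  have "module (class_ring :: ratfun ring) (bt_algebra n)"
  proof (rule moduleI)
    show "cring (class_ring :: ratfun ring)" by (rule domain.axioms(1)[OF field.axioms(1)[OF class_field]])
    show "abelian_group (bt_algebra n)" by (rule ab)
  qed (auto simp: bt_algebra_carrier bt_algebra_add bt_algebra_smult rescale_elem rescale_add r1' r2 r3
      intro!: imageI rescale_elem)
  thus ?thesis by (intro vectorspace.intro class_field)
qed

section \<open>The dimension\<close>

text \<open>
  Restricting the generated relation to \<open>A\<close> gives back the pairs inside blocks, and these determine
  the partition.
\<close>

lemma eqcl_block_pairs_inj:
  assumes "partition_on A P" "partition_on A Q" "eqcl (block_pairs P) = eqcl (block_pairs Q)"
  shows "P = Q"
proof -
  have *: "eqcl (block_pairs P) \<inter> A \<times> A = block_pairs P \<and> A // block_pairs P = P"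
    if "partition_on A P" for P
  proof -
    have r: "block_pairs P = {(x, y). \<exists>p\<in>P. x \<in> p \<and> y \<in> p}"
      by (auto simp: block_pairs_def)
    have e: "equiv A (block_pairs P)" unfolding r by (rule equiv_partition_on[OF that])
    have "equiv UNIV (block_pairs P \<union> Id)"
    proof (rule equivI)
      show "sym (block_pairs P \<union> Id)" by (auto simp: sym_def block_pairs_def)
      have "trans (block_pairs P)" using e by (rule equivE)
      thus "trans (block_pairs P \<union> Id)" by (auto simp: trans_def)
    qed (auto simp: refl_on_def)
    hence "eqcl (block_pairs P) \<subseteq> block_pairs P \<union> Id" by (rule eqcl_least) simp
    moreover have "(a, a) \<in> block_pairs P" if "a \<in> A" for a
      using e that by (auto elim!: equivE dest: refl_onD)
    moreover have "block_pairs P \<subseteq> A \<times> A" using e by (auto elim!: equivE)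
    ultimately have "eqcl (block_pairs P) \<inter> A \<times> A = block_pairs P"
      using eqcl_superset[of "block_pairs P"] by blast
    thus ?thesis using partition_on_eq_quotient[OF that] by (simp add: r)
  qed
  show ?thesis using *[OF assms(1)] *[OF assms(2)] assms(3) by metis
qed

text \<open>
  By \<open>act_ideal\<close> the pairing does not depend on the representative chosen here.
\<close>

definition ideal_class_pairing :: "bt_free set \<Rightarrow> bt_fun \<Rightarrow> ratfun" where
  "ideal_class_pairing X f = pairing (SOME p. p \<in> X) f"

lemma pairing_add [simp]: "pairing (p + q) f = pairing p f + pairing q f"
  and pairing_scale [simp]: "pairing (scale a p) f = laurent_to_ratfun a * pairing p f"
  and pairing_diff [simp]: "pairing (p - q) f = pairing p f - pairing q f"
  by (simp_all add: pairing_def)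

lemma ideal_class_pairing_ideal_class: "p \<in> bt_elems n \<Longrightarrow> ideal_class_pairing (ideal_class n p) f = pairing p f"
proof -
  assume p: "p \<in> bt_elems n"
  hence "p \<in> ideal_class n p" by (simp add: ideal_class_eq cong_bt_refl)
  hence "(SOME q. q \<in> ideal_class n p) \<in> ideal_class n p" by (rule someI)
  hence "cong_bt n (SOME q. q \<in> ideal_class n p) p" using p by (simp add: ideal_class_eq)
  hence "pairing ((SOME q. q \<in> ideal_class n p) - p) f = 0"
    unfolding cong_bt_def pairing_def by (intro act_ideal) auto
  thus ?thesis by (simp add: ideal_class_pairing_def)
qed

text \<open>
  The additive extension of \<open>X \<otimes> x \<mapsto> x * ideal_class_pairing X f\<close> to formal sums.
\<close>

definition tens_pairing :: "(bt_free set \<times> ratfun \<Rightarrow>\<^sub>0 int) \<Rightarrow> bt_fun \<Rightarrow> ratfun" where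
  "tens_pairing c f = (\<Sum>z\<in>Poly_Mapping.keys c.
     of_int (Poly_Mapping.lookup c z) * (snd z * ideal_class_pairing (fst z) f))"

lemma tens_pairing_add: "tens_pairing (c + d) f = tens_pairing c f + tens_pairing d f"
  unfolding tens_pairing_def by (rule setsum_keys_plus_distrib) (simp_all add: distrib_right)

lemma tens_pairing_0 [simp]: "tens_pairing 0 f = 0"
  by (simp add: tens_pairing_def)

lemma tens_pairing_diff: "tens_pairing (c - d) f = tens_pairing c f - tens_pairing d f"
  using tens_pairing_add[of "c - d" d f] by simp

lemma tens_pairing_pure: "p \<in> bt_elems n \<Longrightarrow> tens_pairing (pure n p x) f = x * pairing p f"
  by (simp add: tens_pairing_def pure_def ideal_class_pairing_ideal_class)

lemma tens_pairing_zero: "c \<in> tens_zero n \<Longrightarrow> tens_pairing c f = 0"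
proof (induction rule: tens_zero_induct)
  case (rel r)
  thus ?case
  proof (cases rule: tensor_relations_cases)
    case (add_left p q x)
    thus ?thesis by (simp add: tens_pairing_diff tens_pairing_pure distrib_left)
  next
    case (add_right p x y)
    thus ?thesis by (simp add: tens_pairing_diff tens_pairing_pure distrib_right)
  next
    case (balanced p a x)
    thus ?thesis by (simp add: tens_pairing_diff tens_pairing_pure)
  qed
qed (simp add: tens_pairing_diff)

lemma tens_pairing_rescale: "tens_elem n c \<Longrightarrow> tens_pairing (rescale y c) f = y * tens_pairing c f"
proof (induction rule: tens_elem_induct)
  case zero
  show ?case by (simp add: rescale_def)
next
  case (diff c d)
  thus ?case by (simp add: rescale_diff tens_pairing_diff right_diff_distrib)
next
  case (pure p x)
  thus ?case by (simp add: tens_pairing_pure)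
qed

definition bt_pairing :: "(bt_free set \<times> ratfun \<Rightarrow>\<^sub>0 int) set \<Rightarrow> bt_fun \<Rightarrow> ratfun" where
  "bt_pairing X f = tens_pairing (SOME c. c \<in> X) f"

lemma bt_pairing_coset: "bt_pairing (tensor_coset n c) f = tens_pairing c f"
proof -
  have "c \<in> tensor_coset n c" by (simp add: mem_tensor_coset_iff tens_zero_0)
  hence "(SOME d. d \<in> tensor_coset n c) \<in> tensor_coset n c" by (rule someI)
  hence "tens_pairing ((SOME d. d \<in> tensor_coset n c) - c) f = 0"
    by (intro tens_pairing_zero) (simp add: mem_tensor_coset_iff)
  thus ?thesis by (simp add: bt_pairing_def tens_pairing_diff)
qed

lemma bt_pairing_add:
  "X \<in> carrier (bt_algebra n) \<Longrightarrow> Y \<in> carrier (bt_algebra n) \<Longrightarrow>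
    bt_pairing (X \<oplus>\<^bsub>bt_algebra n\<^esub> Y) f = bt_pairing X f + bt_pairing Y f"
  by (auto simp: bt_algebra_carrier bt_algebra_add bt_pairing_coset tens_pairing_add)

lemma bt_pairing_zero: "bt_pairing \<zero>\<^bsub>bt_algebra n\<^esub> f = 0"
  by (simp add: bt_algebra_zero bt_pairing_coset)

lemma bt_pairing_smult:
  "X \<in> carrier (bt_algebra n) \<Longrightarrow> bt_pairing (y \<odot>\<^bsub>bt_algebra n\<^esub> X) f = y * bt_pairing X f"
  by (auto simp: bt_algebra_carrier bt_algebra_smult bt_pairing_coset tens_pairing_rescale)

definition simple_tensor :: "nat \<Rightarrow> bt_free \<Rightarrow> ratfun \<Rightarrow> (bt_free set \<times> ratfun \<Rightarrow>\<^sub>0 int) set" where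
  "simple_tensor n p x = tensor_coset n (pure n p x)"

lemma simple_tensor_carrier: "p \<in> bt_elems n \<Longrightarrow> simple_tensor n p x \<in> carrier (bt_algebra n)"
  using pure_elem by (auto simp: simple_tensor_def bt_algebra_carrier)

lemma simple_tensor_add:
  assumes "p \<in> bt_elems n" "q \<in> bt_elems n"
  shows "simple_tensor n (p + q) x = simple_tensor n p x \<oplus>\<^bsub>bt_algebra n\<^esub> simple_tensor n q x"
  using tens_zero_rel[OF tensor_relations_intros(1)[OF assms, of x]] assms
  by (simp add: simple_tensor_def bt_algebra_add[OF pure_elem pure_elem] tensor_coset_eq_iff diff_diff_add)

lemma simple_tensor_scale:
  assumes "p \<in> bt_elems n"
  shows "simple_tensor n (scale a p) x = (laurent_to_ratfun a * x) \<odot>\<^bsub>bt_algebra n\<^esub> simple_tensor n p 1"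
  using tens_zero_rel[OF tensor_relations_intros(3)[OF assms assms, of a x]]
  by (simp add: simple_tensor_def bt_algebra_smult tensor_coset_eq_iff)

lemma simple_tensor_cong: "cong_bt n p q \<Longrightarrow> simple_tensor n p x = simple_tensor n q x"
  by (simp add: simple_tensor_def pure_def ideal_class_cong)

lemma simple_tensor_zero: "simple_tensor n 0 x = \<zero>\<^bsub>bt_algebra n\<^esub>"
proof -
  have "pure n (0 + 0) x - pure n 0 x - pure n 0 x \<in> tens_zero n"
    by (intro tens_zero_rel tensor_relations_intros) simp_all
  hence "pure n 0 x \<in> tens_zero n" using tens_zero_uminus[of "- pure n 0 x" n] by simp
  thus ?thesis by (simp add: simple_tensor_def bt_algebra_zero tensor_coset_eq_iff)
qed

text \<open>
  Every element is a sum of pure tensors \<open>p \<otimes> x\<close>. Writing \<open>p\<close> as a combination of the \<open>g b\<close> and moving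
  the coefficients to the right factor gives a combination of the \<open>g b \<otimes> 1\<close>.
\<close>

lemma bt_algebra_generated:
  assumes V: "submodule (class_ring :: ratfun ring) N (bt_algebra n)"
    and B: "finite B" "g ` B \<subseteq> bt_elems n" "\<And>b. b \<in> B \<Longrightarrow> simple_tensor n (g b) 1 \<in> N"
    and span: "\<forall>p\<in>bt_elems n. \<exists>c. cong_bt n p (\<Sum>b\<in>B. scale (c b) (g b))"
  shows "carrier (bt_algebra n) \<subseteq> N"
proof -
  interpret vectorspace "class_ring :: ratfun ring" "bt_algebra n" by (rule vectorspace_bt_algebra)
  have smult: "y \<odot>\<^bsub>bt_algebra n\<^esub> X \<in> N" if "X \<in> N" for X y
    using submodule.smult_closed[OF V _ that] by simp
  have add: "X \<oplus>\<^bsub>bt_algebra n\<^esub> Y \<in> N" if "X \<in> N" "Y \<in> N" for X Y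
    using submodule.m_closed[OF V that] .
  have sum: "simple_tensor n (\<Sum>b\<in>C. scale (c b) (g b)) x \<in> N \<and> (\<Sum>b\<in>C. scale (c b) (g b)) \<in> bt_elems n"
    if "C \<subseteq> B" for c x C
    using finite_subset[OF that B(1)] that
  proof (induction rule: finite_induct)
    case empty
    show ?case using submodule.zero_closed[OF V] by (simp add: simple_tensor_zero)
  next
    case (insert b C)
    have gb: "g b \<in> bt_elems n" using insert.prems B(2) by auto
    show ?case using insert gb B(3)[of b]
      by (simp add: simple_tensor_add simple_tensor_scale add smult)
  qed
  have "tensor_coset n c \<in> N" if "tens_elem n c" for c
    using that
  proof (induction rule: tens_elem_induct)
    case zero
    show ?case using submodule.zero_closed[OF V] by (simp add: bt_algebra_zero)
  next
    case (diff c d)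
    have "tensor_coset n c \<oplus>\<^bsub>bt_algebra n\<^esub> ((- 1) \<odot>\<^bsub>bt_algebra n\<^esub> tensor_coset n d) = tensor_coset n (c + rescale (- 1) d)"
      using diff by (simp add: bt_algebra_smult bt_algebra_add rescale_elem)
    also have "\<dots> = tensor_coset n (c - d)"
    proof -
      have "rescale (- 1) d + d \<in> tens_zero n"
        using diff(2)
      proof (induction rule: tens_elem_induct)
        case zero
        show ?case by (simp add: rescale_def tens_zero_0)
      next
        case (diff c d)
        have "rescale (- 1) (c - d) + (c - d) = (rescale (- 1) c + c) - (rescale (- 1) d + d)"
          by (simp add: rescale_diff)
        thus ?case using diff tens_zero_diff by metis
      next
        case (pure p x)
        have z: "pure n p 0 \<in> tens_zero n"
        proof -
          have "pure n p (0 + 0) - pure n p 0 - pure n p 0 \<in> tens_zero n"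
            using pure by (intro tens_zero_rel tensor_relations_intros)
          thus ?thesis using tens_zero_uminus[of "- pure n p 0" n] by simp
        qed
        have "pure n p (- x + x) - pure n p (- x) - pure n p x \<in> tens_zero n"
          using pure by (intro tens_zero_rel tensor_relations_intros)
        from tens_zero_diff[OF z this] show ?case by (simp add: algebra_simps)
      qed
      thus ?thesis by (simp add: tensor_coset_eq_iff)
    qed
    finally show ?case using add smult diff by metis
  next
    case (pure p x)
    then obtain c where "cong_bt n p (\<Sum>b\<in>B. scale (c b) (g b))" using span by blast
    thus ?case using sum[of B c x] simple_tensor_cong by (simp add: simple_tensor_def)
  qed
  thus ?thesis by (auto simp: bt_algebra_carrier)
qed

lemma bt_pairing_lincomb:
  assumes "finite S" "S \<subseteq> carrier (bt_algebra n)"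
  shows "bt_pairing (module.lincomb (bt_algebra n) a S) f = (\<Sum>v\<in>S. a v * bt_pairing v f)"
proof -
  interpret vectorspace "class_ring :: ratfun ring" "bt_algebra n" by (rule vectorspace_bt_algebra)
  have sm: "a v \<odot>\<^bsub>bt_algebra n\<^esub> v \<in> carrier (bt_algebra n)" if "v \<in> carrier (bt_algebra n)" for v
    using that by (intro smult_closed) simp_all
  show ?thesis
    using assms unfolding lincomb_def
  proof (induction S rule: finite_induct)
    case empty
    show ?case by (simp add: bt_pairing_zero)
  next
    case (insert v S)
    have "(\<Oplus>\<^bsub>bt_algebra n\<^esub>v\<in>S. a v \<odot>\<^bsub>bt_algebra n\<^esub> v) \<in> carrier (bt_algebra n)"
      using insert.prems sm by (intro finsum_closed) auto
    moreover have "(\<Oplus>\<^bsub>bt_algebra n\<^esub>v\<in>insert v S. a v \<odot>\<^bsub>bt_algebra n\<^esub> v)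
        = a v \<odot>\<^bsub>bt_algebra n\<^esub> v \<oplus>\<^bsub>bt_algebra n\<^esub> (\<Oplus>\<^bsub>bt_algebra n\<^esub>v\<in>S. a v \<odot>\<^bsub>bt_algebra n\<^esub> v)"
      using insert sm by (intro finsum_insert) auto
    ultimately show ?case
      using insert sm by (simp add: bt_pairing_add bt_pairing_smult)
  qed
qed

text \<open>
  The spanning set has at most \<open>n! B\<^sub>n\<close> elements. On the other hand there are \<open>n! B\<^sub>n\<close> elements whose
  pairings are the evaluations at the different points \<open>(A, w)\<close>; applying these to indicator
  functions of points shows that the elements are linearly independent.
\<close>

theorem dimension_bt_algebra: "has_dim (class_ring :: ratfun ring) (bt_algebra n) (fact n * bell n)"
proof -
  interpret vectorspace "class_ring :: ratfun ring" "bt_algebra n" by (rule vectorspace_bt_algebra)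
  obtain B :: "bt_family set" and g where B: "finite B" "card B \<le> fact n * bell n" "g ` B \<subseteq> bt_elems n"
    and span: "\<forall>p\<in>bt_elems n. \<exists>c. cong_bt n p (\<Sum>b\<in>B. scale (c b) (g b))"
    using bt_spanning[of n] by blast
  define S where "S = (\<lambda>b. simple_tensor n (g b) 1) ` B"
  have S: "finite S" "S \<subseteq> carrier (bt_algebra n)" "card S \<le> fact n * bell n"
    using B card_image_le[OF B(1), of "\<lambda>b. simple_tensor n (g b) 1"]
    by (auto simp: S_def intro: simple_tensor_carrier)
  have "carrier (bt_algebra n) \<subseteq> span S"
    using span_is_submodule[OF S(2)] B(1,3) _ span
  proof (rule bt_algebra_generated)
    show "simple_tensor n (g b) 1 \<in> span S" if "b \<in> B" for b
      using in_own_span[OF S(2)] that by (auto simp: S_def)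
  qed
  hence gen: "gen_set S" using span_is_subset2[OF S(2)] by blast
  hence fd: "fin_dim" unfolding fin_dim_def using S by blast

  define I where "I = {P. partition_on {1..n} P} \<times> {w. w permutes {1..n}}"
  have "\<exists>p. p \<in> bt_elems n \<and> (\<forall>f. pairing p f = f (eqcl (block_pairs (fst k))) (snd k))" if "k \<in> I" for k
  proof -
    have P: "partition_on {1..n} (fst k)" and w: "snd k permutes {1..n}" using that by (auto simp: I_def)
    have "block_pairs (fst k) \<subseteq> {1..n} \<times> {1..n}"
      using partition_onD1[OF P] by (auto simp: block_pairs_def)
    from reached_all[OF finite_subset[OF this] this w] show ?thesis
      by (auto simp: reached_def)
  qed
  then obtain h where h: "\<And>k. k \<in> I \<Longrightarrow> h k \<in> bt_elems n"
    "\<And>k f. k \<in> I \<Longrightarrow> pairing (h k) f = f (eqcl (block_pairs (fst k))) (snd k)"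
    by metis
  define u where "u k = simple_tensor n (h k) 1" for k
  \<comment> \<open>the indicator function of a point \<open>(A, w)\<close>\<close>
  define \<delta> :: "nat set set \<times> (nat \<Rightarrow> nat) \<Rightarrow> bt_fun" where
    "\<delta> k A w = (if A = eqcl (block_pairs (fst k)) \<and> w = snd k then 1 else 0)" for k A w
  have dual: "bt_pairing (u k) (\<delta> l) = (if k = l then 1 else 0)" if "k \<in> I" "l \<in> I" for k l
  proof -
    have "bt_pairing (u k) (\<delta> l) = \<delta> l (eqcl (block_pairs (fst k))) (snd k)"
      using that h by (simp add: u_def simple_tensor_def bt_pairing_coset tens_pairing_pure)
    moreover have "eqcl (block_pairs (fst k)) = eqcl (block_pairs (fst l)) \<longleftrightarrow> fst k = fst l"
      using eqcl_block_pairs_inj[of "{1..n}" "fst k" "fst l"] that by (auto simp: I_def)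
    ultimately show ?thesis by (auto simp: \<delta>_def prod_eq_iff)
  qed
  have inj: "inj_on u I"
  proof (rule inj_onI)
    fix k l assume "k \<in> I" "l \<in> I" "u k = u l"
    thus "k = l" using dual[of k l] dual[of l l] by (auto split: if_splits)
  qed
  have fin: "finite I" and cI: "card I = fact n * bell n"
    by (auto simp: I_def bell_def finitely_many_partition_on finite_permutations card_cartesian_product card_permutations)
  have uI: "u ` I \<subseteq> carrier (bt_algebra n)" using h(1) by (auto simp: u_def intro: simple_tensor_carrier)
  have li: "lin_indpt (u ` I)"
  proof
    assume "lin_dep (u ` I)"
    then obtain A a v where A: "finite A" "A \<subseteq> u ` I" "lincomb a A = \<zero>\<^bsub>bt_algebra n\<^esub>" "v \<in> A" "a v \<noteq> 0"
      unfolding lin_dep_def by auto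
    then obtain l where l: "l \<in> I" "v = u l" by auto
    have "0 = bt_pairing (lincomb a A) (\<delta> l)" by (simp add: A(3) bt_pairing_zero)
    also have "\<dots> = (\<Sum>x\<in>A. a x * bt_pairing x (\<delta> l))"
      using A uI by (intro bt_pairing_lincomb) auto
    also have "\<dots> = (\<Sum>x\<in>A. if x = v then a v else 0)"
    proof (rule sum.cong[OF refl])
      fix x assume "x \<in> A"
      then obtain k where "k \<in> I" "x = u k" using A by auto
      thus "a x * bt_pairing x (\<delta> l) = (if x = v then a v else 0)"
        using dual[of k l] l inj by (auto simp: inj_on_eq_iff)
    qed
    also have "\<dots> = a v" using A by simp
    finally show False using A(5) by simp
  qed
  have "card (u ` I) \<le> dim" by (rule li_le_dim(2)[OF fd uI li])
  hence "fact n * bell n \<le> dim" using card_image[OF inj] cI by simp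
  moreover have "dim \<le> fact n * bell n" using gen_ge_dim[OF S(1,2) gen] S(3) by simp
  ultimately show ?thesis
    unfolding has_dim_def using vectorspace_bt_algebra fd by simp
qed

section \<open>Small Bell numbers\<close>

text \<open>
  The new point is a block of its own or is added to a block of a partition of the other points.
\<close>

lemma partitions_insert:
  assumes "a \<notin> A"
  shows "{P. partition_on (insert a A) P} =
    (\<Union>Q\<in>{Q. partition_on A Q}. insert (insert {a} Q) ((\<lambda>X. insert (insert a X) (Q - {X})) ` Q))"
proof (intro equalityI subsetI)
  fix P assume "P \<in> {P. partition_on (insert a A) P}"
  hence P: "partition_on (insert a A) P" by simp
  then obtain Y where Y: "Y \<in> P" "a \<in> Y" using partition_onD1 by blast
  have dis: "disjnt Y (\<Union>(P - {Y}))"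
    using partition_onD2[OF P] Y by (auto simp: disjnt_def disjoint_def)
  have PY: "insert Y (P - {Y}) = P" using Y by blast
  have rest: "partition_on (insert a A - Y) (P - {Y})" "Y \<subseteq> insert a A"
    using partition_on_insert[OF dis, of "insert a A"] P PY by auto
  show "P \<in> (\<Union>Q\<in>{Q. partition_on A Q}. insert (insert {a} Q) ((\<lambda>X. insert (insert a X) (Q - {X})) ` Q))"
  proof (cases "Y = {a}")
    case True
    hence "partition_on A (P - {Y})" using rest assms by simp
    thus ?thesis using PY True by blast
  next
    case False
    \<comment> \<open>Without the new point, its block becomes a block of a partition of \<open>A\<close>.\<close>
    let ?X = "Y - {a}"
    have X: "?X \<noteq> {}" "?X \<subseteq> A" "A - ?X = insert a A - Y" using False Y rest assms by auto
    have dX: "disjnt ?X (\<Union>(P - {Y}))" using dis by (auto simp: disjnt_def)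
    have nX: "?X \<notin> P - {Y}" using dX X(1) by (auto simp: disjnt_def)
    have Q: "partition_on A (insert ?X (P - {Y}))"
      using partition_on_insert[OF dX, of A] X rest by simp
    have "insert (insert a ?X) (insert ?X (P - {Y}) - {?X}) = P"
      using nX PY Y by (simp add: insert_absorb)
    hence "P \<in> (\<lambda>X. insert (insert a X) (insert ?X (P - {Y}) - {X})) ` insert ?X (P - {Y})"
      by (intro image_eqI[of _ _ ?X]) simp_all
    thus ?thesis using Q by (intro UN_I[of "insert ?X (P - {Y})"] insertI2) simp_all
  qed
next
  fix P assume "P \<in> (\<Union>Q\<in>{Q. partition_on A Q}. insert (insert {a} Q) ((\<lambda>X. insert (insert a X) (Q - {X})) ` Q))"
  then obtain Q where Q: "partition_on A Q"
    and "P = insert {a} Q \<or> (\<exists>X\<in>Q. P = insert (insert a X) (Q - {X}))" by auto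
  from this(2) show "P \<in> {P. partition_on (insert a A) P}"
  proof
    assume P: "P = insert {a} Q"
    have "disjnt {a} (\<Union>Q)" using assms partition_onD1[OF Q] by auto
    from partition_on_insert[OF this, of "insert a A"] show ?thesis using Q P assms by simp
  next
    assume "\<exists>X\<in>Q. P = insert (insert a X) (Q - {X})"
    then obtain X where X: "X \<in> Q" "P = insert (insert a X) (Q - {X})" by blast
    have d: "disjnt X (\<Union>(Q - {X}))"
      using partition_onD2[OF Q] X by (auto simp: disjnt_def disjoint_def)
    have XA: "X \<subseteq> A" using X partition_onD1[OF Q] by blast
    have Q1: "partition_on (A - X) (Q - {X})"
      using partition_on_insert[OF d, of A] Q X insert_Diff[OF X(1)] by simp
    have d': "disjnt (insert a X) (\<Union>(Q - {X}))"
      using d assms partition_onD1[OF Q] by (auto simp: disjnt_def)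
    have "insert a A - insert a X = A - X" using assms by auto
    thus ?thesis
      using partition_on_insert[OF d', of "insert a A"] Q1 X(2) XA by auto
  qed
qed

lemma bell_2: "bell 2 = 2" and bell_3: "bell 3 = 5"
proof -
  have 0: "{P. partition_on {} P} = {{}}" by (auto simp: partition_on_empty)
  have 1: "{P. partition_on {1::nat} P} = {{{1}}}"
    using partitions_insert[of "1::nat" "{}"] unfolding 0 by simp
  have 2: "{P. partition_on {2, 1::nat} P} = {{{2}, {1}}, {{2, 1}}}"
    using partitions_insert[of "2::nat" "{1}"] unfolding 1 by simp
  have n: "(3::nat) \<notin> {2, 1}" "{{2}, {1::nat}} - {{2}} = {{1}}" "{{2}, {1::nat}} - {{1}} = {{2}}"
    by (auto simp: set_eq_subset)
  have 3: "{P. partition_on {3, 2, 1::nat} P} =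
      {{{3}, {2, 1}}, {{3, 2, 1}}, {{3}, {2}, {1}}, {{3, 2}, {1}}, {{3, 1}, {2}}}"
    using partitions_insert[OF n(1)] n(2,3) unfolding 2 by simp
  have i: "{1..2} = {2, 1::nat}" "{1..3} = {3, 2, 1::nat}" by auto
  show "bell 2 = 2" unfolding bell_def i 2 by (simp add: set_eq_subset)
  show "bell 3 = 5" unfolding bell_def i 3 by (simp add: set_eq_subset)
qed

theorem corollary3:
  shows "(\<forall>n. has_dim (class_ring :: ratfun ring) (bt_algebra n) (fact n * bell n)) \<and>
    has_dim (class_ring :: ratfun ring) (bt_algebra 2) 4 \<and>
    has_dim (class_ring :: ratfun ring) (bt_algebra 3) 30"
  using dimension_bt_algebra dimension_bt_algebra[of 2] dimension_bt_algebra[of 3]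
  by (simp add: bell_2 bell_3 fact_numeral)

end
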